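(* Let $G$ be a group, let $d>0$ be an integer, and let $M$ be a $\mathbb{Z}G$-module of type $FP_{d+1}$. Then: (1) For all positive integers $k$, $\mathrm{FV}_M^{d+1}(k)<\infty$ (whatever the choices of resolution and filling norms used to define $\mathrm{FV}_M^{d+1}$). (2) The growth rate class of the function $\mathrm{FV}_M^{d+1}\colon\mathbb{N}\to\mathbb{N}$ depends only on $M$; that is, if $f$ and $g$ are the functions $\mathrm{FV}_M^{d+1}$ obtained from two choices of resolution and filling norms, then $f\sim g$.
   Context: A $\mathbb{Z}G$-module $M$ is of type $FP_n$ if there is a partial resolution (exact sequence of $\mathbb{Z}G$-modules) $P_n\xrightarrow{\varphi_n}P_{n-1}\to\cdots\xrightarrow{\varphi_1}P_0\to M\to 0$ with each $P_i$ a finitely generated projective $\mathbb{Z}G$-module; such a sequence is called an $FP_n$-resolution of $M$. Filling norms: if $F$ is a finitely generated free $\mathbb{Z}G$-module with a chosen finite $\mathbb{Z}G$-basis $\{\alpha_i : i\in I\}$, then $F$ is a free abelian group on $\{g\alpha_i : g\in G, i\in I\}$, and $\|\cdot\|_F$ denotes the $\ell_1$-norm (sum of absolute values of coefficients) with respect to this $\mathbb{Z}$-basis. If $\eta\colon F\to N$ is a surjective morphism of $\mathbb{Z}G$-modules, where $F$ is a finitely generated free $\mathbb{Z}G$-module with a chosen finite $\mathbb{Z}G$-basis $\{\alpha_i : i\in I\}$ and $\|\cdot\|_F$ is the $\ell_1$-norm with respect to the $\mathbb{Z}$-basis $\{g\alpha_i : g\in G, i\in I\}$, the induced filling norm on $N$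 is $\|m\|_\eta=\min\{\|x\|_F : x\in F,\ \eta(x)=m\}$. A filling norm on a finitely generated $\mathbb{Z}G$-module $N$ is any norm arising in this way. The $(d+1)$-filling function $\mathrm{FV}_M^{d+1}\colon\mathbb{N}\to\mathbb{N}\cup\{\infty\}$ of a module $M$ of type $FP_{d+1}$ is defined as follows. Choose an $FP_{d+1}$-resolution $P_{d+1}\xrightarrow{\varphi_{d+1}}P_d\xrightarrow{\varphi_d}\cdots\xrightarrow{\varphi_1}P_0\to M\to 0$ and filling norms $\|\cdot\|_{P_{d+1}}$ on $P_{d+1}$ and $\|\cdot\|_{P_d}$ on $P_d$. Then $$\mathrm{FV}_M^{d+1}(k)=\sup\{\|x\|_{\varphi_{d+1}} : x\in\ker\varphi_d,\ \|x\|_{P_d}\le k\},\quad \|x\|_{\varphi_{d+1}}=\min\{\|y\|_{P_{d+1}} : y\in P_{d+1},\ \varphi_{d+1}(y)=x\}.$$ Growth rate class: for $f,g\colon\mathbb{N}\to\mathbb{N}$, write $f\preceq g$ if there is $C>0$ (an integer) such that $f(n)\le Cg(Cn+C)+Cn+C$ for all $n\in\mathbb{N}$, and $f\sim g$ if $f\preceq g$ and $g\preceq f$. The growth rate class of $f$ is its equivalence class under $\sim$. *)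

theory Defs
  imports "HOL-Algebra.Module" "HOL-Algebra.AbelCoset" "HOL-Library.Extended_Nat"
begin

section \<open>The integral group ring\<close>

text \<open>An element of the group ring is the function sending a group element to its coefficient.\<close>

definition group_ring :: "('g, 'x) monoid_scheme \<Rightarrow> ('g \<Rightarrow> int) ring" where
  "group_ring G =
    \<lparr> carrier = {a. finite {g. a g \<noteq> 0} \<and> {g. a g \<noteq> 0} \<subseteq> carrier G},
      mult = (\<lambda>a b x. \<Sum>(g, h)\<in>{(g, h). a g \<noteq> 0 \<and> b h \<noteq> 0 \<and> g \<otimes>\<^bsub>G\<^esub> h = x}. a g * b h),
      one = (\<lambda>x. if x = \<one>\<^bsub>G\<^esub> then 1 else 0),
      zero = (\<lambda>x. 0),
      add = (\<lambda>a b x. a x + b x) \<rparr>"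

definition group_ring_of :: "'g \<Rightarrow> 'g \<Rightarrow> int" where
  "group_ring_of g = (\<lambda>x. if x = g then 1 else 0)"

lemma group_ring_mult_eq:
  assumes A: "finite A" "{g. a g \<noteq> 0} \<subseteq> A" and B: "finite B" "{g. b g \<noteq> 0} \<subseteq> B"
  shows "(a \<otimes>\<^bsub>group_ring G\<^esub> b) x =
    (\<Sum>g\<in>A. \<Sum>h\<in>B. if g \<otimes>\<^bsub>G\<^esub> h = x then a g * b h else 0)"
proof -
  have "(a \<otimes>\<^bsub>group_ring G\<^esub> b) x =
      (\<Sum>(g, h)\<in>{(g, h). a g \<noteq> 0 \<and> b h \<noteq> 0 \<and> g \<otimes>\<^bsub>G\<^esub> h = x}. a g * b h)"
    by (simp add: group_ring_def)
  also have "\<dots> = (\<Sum>(g, h)\<in>A \<times> B. if g \<otimes>\<^bsub>G\<^esub> h = x then a g * b h else 0)"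
    by (rule sum.mono_neutral_cong_left) (use A B in \<open>auto split: if_splits\<close>)
  finally show ?thesis by (simp add: sum.cartesian_product)
qed

lemma group_ring_mult_closed:
  assumes "group G" "a \<in> carrier (group_ring G)" "b \<in> carrier (group_ring G)"
  shows "a \<otimes>\<^bsub>group_ring G\<^esub> b \<in> carrier (group_ring G)"
proof -
  interpret group G by fact
  define S where "S = (\<lambda>(g, h). g \<otimes>\<^bsub>G\<^esub> h) ` ({g. a g \<noteq> 0} \<times> {g. b g \<noteq> 0})"
  have "{x. (a \<otimes>\<^bsub>group_ring G\<^esub> b) x \<noteq> 0} \<subseteq> S"
  proof
    fix x assume x: "x \<in> {x. (a \<otimes>\<^bsub>group_ring G\<^esub> b) x \<noteq> 0}"
    have "{(g, h). a g \<noteq> 0 \<and> b h \<noteq> 0 \<and> g \<otimes>\<^bsub>G\<^esub> h = x} \<noteq> {}"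
    proof
      assume "{(g, h). a g \<noteq> 0 \<and> b h \<noteq> 0 \<and> g \<otimes>\<^bsub>G\<^esub> h = x} = {}"
      hence "(a \<otimes>\<^bsub>group_ring G\<^esub> b) x = 0" by (simp only: group_ring_def monoid.select_convs sum.empty)
      thus False using x by simp
    qed
    thus "x \<in> S" unfolding S_def by force
  qed
  moreover have "finite S" "S \<subseteq> carrier G"
    using assms(2,3) by (auto simp: S_def group_ring_def)
  ultimately show ?thesis by (simp add: group_ring_def) (meson finite_subset subset_trans)
qed

lemma group_ring_mult_assoc:
  assumes "group G" "a \<in> carrier (group_ring G)" "b \<in> carrier (group_ring G)"
    "c \<in> carrier (group_ring G)"
  shows "(a \<otimes>\<^bsub>group_ring G\<^esub> b) \<otimes>\<^bsub>group_ring G\<^esub> c = a \<otimes>\<^bsub>group_ring G\<^esub> (b \<otimes>\<^bsub>group_ring G\<^esub> c)"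
proof
  fix x
  interpret group G by fact
  let ?m = "\<lambda>a b. a \<otimes>\<^bsub>group_ring G\<^esub> b"
  define A B C where "A = {g. a g \<noteq> 0}" "B = {g. b g \<noteq> 0}" "C = {g. c g \<noteq> 0}"
  define AB BC where "AB = (\<lambda>(g, h). g \<otimes>\<^bsub>G\<^esub> h) ` (A \<times> B) \<union> {g. ?m a b g \<noteq> 0}"
    and "BC = (\<lambda>(g, h). g \<otimes>\<^bsub>G\<^esub> h) ` (B \<times> C) \<union> {g. ?m b c g \<noteq> 0}"
  note clo = group_ring_mult_closed[OF assms(1)]
  have fin: "finite A" "finite B" "finite C" "A \<subseteq> carrier G" "B \<subseteq> carrier G" "C \<subseteq> carrier G"
    using assms by (auto simp: A_B_C_def group_ring_def)
  have fin2: "finite AB" "finite BC"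
    using fin clo[OF assms(2,3)] clo[OF assms(3,4)] by (auto simp: AB_def BC_def group_ring_def)
  have "?m (?m a b) c x = (\<Sum>y\<in>AB. \<Sum>k\<in>C. if y \<otimes>\<^bsub>G\<^esub> k = x then ?m a b y * c k else 0)"
    by (rule group_ring_mult_eq) (use fin fin2 in \<open>auto simp: AB_def A_B_C_def\<close>)
  also have "\<dots> = (\<Sum>k\<in>C. \<Sum>y\<in>AB. if y \<otimes>\<^bsub>G\<^esub> k = x then ?m a b y * c k else 0)"
    by (rule sum.swap)
  also have "\<dots> = (\<Sum>k\<in>C. \<Sum>y\<in>AB. \<Sum>g\<in>A. \<Sum>h\<in>B.
      if g \<otimes>\<^bsub>G\<^esub> h = y \<and> y \<otimes>\<^bsub>G\<^esub> k = x then a g * b h * c k else 0)"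
    by (intro sum.cong refl, subst group_ring_mult_eq[of A a B b])
       (use fin in \<open>auto simp: A_B_C_def sum_distrib_right intro!: sum.cong sum.neutral\<close>)
  also have "\<dots> = (\<Sum>k\<in>C. \<Sum>g\<in>A. \<Sum>h\<in>B. \<Sum>y\<in>AB.
      if g \<otimes>\<^bsub>G\<^esub> h = y \<and> y \<otimes>\<^bsub>G\<^esub> k = x then a g * b h * c k else 0)"
  proof (rule sum.cong[OF refl])
    fix k
    let ?f = "\<lambda>y g h. if g \<otimes>\<^bsub>G\<^esub> h = y \<and> y \<otimes>\<^bsub>G\<^esub> k = x then a g * b h * c k else 0"
    have "(\<Sum>y\<in>AB. \<Sum>g\<in>A. \<Sum>h\<in>B. ?f y g h) = (\<Sum>g\<in>A. \<Sum>y\<in>AB. \<Sum>h\<in>B. ?f y g h)"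
      by (rule sum.swap)
    also have "\<dots> = (\<Sum>g\<in>A. \<Sum>h\<in>B. \<Sum>y\<in>AB. ?f y g h)"
      by (intro sum.cong refl sum.swap)
    finally show "(\<Sum>y\<in>AB. \<Sum>g\<in>A. \<Sum>h\<in>B. ?f y g h) = (\<Sum>g\<in>A. \<Sum>h\<in>B. \<Sum>y\<in>AB. ?f y g h)" .
  qed
  also have "\<dots> = (\<Sum>k\<in>C. \<Sum>g\<in>A. \<Sum>h\<in>B.
      if (g \<otimes>\<^bsub>G\<^esub> h) \<otimes>\<^bsub>G\<^esub> k = x then a g * b h * c k else 0)"
  proof (intro sum.cong refl)
    fix k g h assume "g \<in> A" "h \<in> B"
    hence "g \<otimes>\<^bsub>G\<^esub> h \<in> AB" by (auto simp: AB_def)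
    moreover have "(\<Sum>y\<in>AB. if g \<otimes>\<^bsub>G\<^esub> h = y \<and> y \<otimes>\<^bsub>G\<^esub> k = x then a g * b h * c k else 0) =
        (\<Sum>y\<in>AB. if g \<otimes>\<^bsub>G\<^esub> h = y then (if g \<otimes>\<^bsub>G\<^esub> h \<otimes>\<^bsub>G\<^esub> k = x then a g * b h * c k else 0) else 0)"
      by (intro sum.cong) auto
    ultimately show "(\<Sum>y\<in>AB. if g \<otimes>\<^bsub>G\<^esub> h = y \<and> y \<otimes>\<^bsub>G\<^esub> k = x then a g * b h * c k else 0) =
        (if g \<otimes>\<^bsub>G\<^esub> h \<otimes>\<^bsub>G\<^esub> k = x then a g * b h * c k else 0)"
      using fin2 by (simp add: sum.delta')
  qed
  also have "\<dots> = (\<Sum>g\<in>A. \<Sum>h\<in>B. \<Sum>k\<in>C.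
      if g \<otimes>\<^bsub>G\<^esub> (h \<otimes>\<^bsub>G\<^esub> k) = x then a g * b h * c k else 0)"
  proof -
    let ?f = "\<lambda>k g h. if (g \<otimes>\<^bsub>G\<^esub> h) \<otimes>\<^bsub>G\<^esub> k = x then a g * b h * c k else 0"
    have "(\<Sum>k\<in>C. \<Sum>g\<in>A. \<Sum>h\<in>B. ?f k g h) = (\<Sum>g\<in>A. \<Sum>k\<in>C. \<Sum>h\<in>B. ?f k g h)"
      by (rule sum.swap)
    also have "\<dots> = (\<Sum>g\<in>A. \<Sum>h\<in>B. \<Sum>k\<in>C. ?f k g h)"
      by (intro sum.cong[OF refl] sum.swap)
    also have "\<dots> = (\<Sum>g\<in>A. \<Sum>h\<in>B. \<Sum>k\<in>C.
        if g \<otimes>\<^bsub>G\<^esub> (h \<otimes>\<^bsub>G\<^esub> k) = x then a g * b h * c k else 0)"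
      by (intro sum.cong refl) (use fin in \<open>simp add: m_assoc subset_iff\<close>)
    finally show ?thesis .
  qed
  also have "\<dots> = (\<Sum>g\<in>A. \<Sum>h\<in>B. \<Sum>k\<in>C. \<Sum>y\<in>BC.
      if h \<otimes>\<^bsub>G\<^esub> k = y \<and> g \<otimes>\<^bsub>G\<^esub> y = x then a g * b h * c k else 0)"
  proof (intro sum.cong refl)
    fix k g h assume "h \<in> B" "k \<in> C"
    hence "h \<otimes>\<^bsub>G\<^esub> k \<in> BC" by (auto simp: BC_def)
    moreover have "(\<Sum>y\<in>BC. if h \<otimes>\<^bsub>G\<^esub> k = y \<and> g \<otimes>\<^bsub>G\<^esub> y = x then a g * b h * c k else 0) =
        (\<Sum>y\<in>BC. if h \<otimes>\<^bsub>G\<^esub> k = y then (if g \<otimes>\<^bsub>G\<^esub> (h \<otimes>\<^bsub>G\<^esub> k) = x then a g * b h * c k else 0) else 0)"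
      by (intro sum.cong) auto
    ultimately show "(if g \<otimes>\<^bsub>G\<^esub> (h \<otimes>\<^bsub>G\<^esub> k) = x then a g * b h * c k else 0) =
       (\<Sum>y\<in>BC. if h \<otimes>\<^bsub>G\<^esub> k = y \<and> g \<otimes>\<^bsub>G\<^esub> y = x then a g * b h * c k else 0)"
      using fin2 by (simp add: sum.delta')
  qed
  also have "\<dots> = (\<Sum>g\<in>A. \<Sum>y\<in>BC. \<Sum>h\<in>B. \<Sum>k\<in>C.
      if h \<otimes>\<^bsub>G\<^esub> k = y \<and> g \<otimes>\<^bsub>G\<^esub> y = x then a g * b h * c k else 0)"
  proof (rule sum.cong[OF refl])
    fix g
    let ?f = "\<lambda>y h k. if h \<otimes>\<^bsub>G\<^esub> k = y \<and> g \<otimes>\<^bsub>G\<^esub> y = x then a g * b h * c k else 0"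
    have "(\<Sum>h\<in>B. \<Sum>k\<in>C. \<Sum>y\<in>BC. ?f y h k) = (\<Sum>h\<in>B. \<Sum>y\<in>BC. \<Sum>k\<in>C. ?f y h k)"
      by (intro sum.cong refl sum.swap)
    also have "\<dots> = (\<Sum>y\<in>BC. \<Sum>h\<in>B. \<Sum>k\<in>C. ?f y h k)"
      by (rule sum.swap)
    finally show "(\<Sum>h\<in>B. \<Sum>k\<in>C. \<Sum>y\<in>BC. ?f y h k) = (\<Sum>y\<in>BC. \<Sum>h\<in>B. \<Sum>k\<in>C. ?f y h k)" .
  qed
  also have "\<dots> = (\<Sum>g\<in>A. \<Sum>y\<in>BC. if g \<otimes>\<^bsub>G\<^esub> y = x then a g * ?m b c y else 0)"
    by (intro sum.cong refl, subst group_ring_mult_eq[of B b C c])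
       (use fin in \<open>auto simp: A_B_C_def sum_distrib_left mult.assoc intro!: sum.cong sum.neutral\<close>)
  also have "\<dots> = ?m a (?m b c) x"
    by (rule group_ring_mult_eq[symmetric]) (use fin fin2 in \<open>auto simp: BC_def A_B_C_def\<close>)
  finally show "?m (?m a b) c x = ?m a (?m b c) x" .
qed

lemma ring_group_ring:
  assumes "group G"
  shows "ring (group_ring G)"
proof (rule ringI)
  interpret group G by fact
  let ?R = "group_ring G"
  have add_sub: "{g. a g + b g \<noteq> 0} \<subseteq> {g. a g \<noteq> 0} \<union> {g. b g \<noteq> 0}" for a b :: "'a \<Rightarrow> int"
    by auto
  show "abelian_group ?R"
  proof (rule abelian_groupI)
    fix a b assume ab: "a \<in> carrier ?R" "b \<in> carrier ?R"
    have "finite {g. a g + b g \<noteq> 0}"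
      by (rule finite_subset[OF add_sub]) (use ab in \<open>auto simp: group_ring_def\<close>)
    moreover have "{g. a g + b g \<noteq> 0} \<subseteq> carrier G"
      by (rule subset_trans[OF add_sub]) (use ab in \<open>auto simp: group_ring_def\<close>)
    ultimately show "a \<oplus>\<^bsub>?R\<^esub> b \<in> carrier ?R" by (simp add: group_ring_def)
  next
    fix a assume a: "a \<in> carrier ?R"
    show "\<exists>y\<in>carrier ?R. y \<oplus>\<^bsub>?R\<^esub> a = \<zero>\<^bsub>?R\<^esub>"
      using a by (intro bexI[of _ "\<lambda>x. - a x"]) (auto simp: group_ring_def)
  qed (auto simp: group_ring_def algebra_simps)
  show "monoid ?R"
  proof (rule monoidI)
    show "\<one>\<^bsub>?R\<^esub> \<in> carrier ?R" by (auto simp: group_ring_def)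
    fix a assume a: "a \<in> carrier ?R"
    define A where "A = {g. a g \<noteq> 0}"
    have A: "finite A" "A \<subseteq> carrier G" "a x = 0" if "x \<notin> A" for x
      using a that by (auto simp: A_def group_ring_def)
    have A1: "finite A" "A \<subseteq> carrier G" using a by (auto simp: A_def group_ring_def)
    have one: "{g. \<one>\<^bsub>?R\<^esub> g \<noteq> 0} \<subseteq> {\<one>\<^bsub>G\<^esub>}" "\<one>\<^bsub>?R\<^esub> \<one>\<^bsub>G\<^esub> = 1" by (auto simp: group_ring_def)
    show "\<one>\<^bsub>?R\<^esub> \<otimes>\<^bsub>?R\<^esub> a = a"
    proof
      fix x
      have "(\<one>\<^bsub>?R\<^esub> \<otimes>\<^bsub>?R\<^esub> a) x = (\<Sum>h\<in>A. if \<one>\<^bsub>G\<^esub> \<otimes>\<^bsub>G\<^esub> h = x then a h else 0)"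
        by (subst group_ring_mult_eq[of "{\<one>\<^bsub>G\<^esub>}" _ A]) (use A1 one in \<open>auto simp: A_def intro!: sum.cong\<close>)
      also have "\<dots> = (\<Sum>h\<in>A. if h = x then a h else 0)"
        by (intro sum.cong) (use A1 in auto)
      also have "\<dots> = a x" using A1 by (auto simp: A_def)
      finally show "(\<one>\<^bsub>?R\<^esub> \<otimes>\<^bsub>?R\<^esub> a) x = a x" .
    qed
    show "a \<otimes>\<^bsub>?R\<^esub> \<one>\<^bsub>?R\<^esub> = a"
    proof
      fix x
      have "(a \<otimes>\<^bsub>?R\<^esub> \<one>\<^bsub>?R\<^esub>) x = (\<Sum>h\<in>A. if h \<otimes>\<^bsub>G\<^esub> \<one>\<^bsub>G\<^esub> = x then a h else 0)"
        by (subst group_ring_mult_eq[of A _ "{\<one>\<^bsub>G\<^esub>}"])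
           (use A1 one in \<open>auto simp: A_def intro!: sum.cong\<close>)
      also have "\<dots> = (\<Sum>h\<in>A. if h = x then a h else 0)"
        by (intro sum.cong) (use A1 in auto)
      also have "\<dots> = a x" using A1 by (auto simp: A_def)
      finally show "(a \<otimes>\<^bsub>?R\<^esub> \<one>\<^bsub>?R\<^esub>) x = a x" .
    qed
  qed (simp_all add: group_ring_mult_closed group_ring_mult_assoc assms)
next
  let ?R = "group_ring G"
  fix a b c assume abc: "a \<in> carrier ?R" "b \<in> carrier ?R" "c \<in> carrier ?R"
  define S where "S = {g. a g \<noteq> 0} \<union> {g. b g \<noteq> 0} \<union> {g. c g \<noteq> 0}"
  have S: "finite S" using abc by (auto simp: S_def group_ring_def)
  have S': "{g. a g \<noteq> 0} \<subseteq> S" "{g. b g \<noteq> 0} \<subseteq> S" "{g. c g \<noteq> 0} \<subseteq> S"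
      "{g. (a \<oplus>\<^bsub>?R\<^esub> b) g \<noteq> 0} \<subseteq> S" by (auto simp: S_def group_ring_def)
  have add: "(u \<oplus>\<^bsub>?R\<^esub> v) x = u x + v x" for u v x by (simp add: group_ring_def)
  show "(a \<oplus>\<^bsub>?R\<^esub> b) \<otimes>\<^bsub>?R\<^esub> c = a \<otimes>\<^bsub>?R\<^esub> c \<oplus>\<^bsub>?R\<^esub> b \<otimes>\<^bsub>?R\<^esub> c"
    by (rule ext, simp only: add group_ring_mult_eq[OF S S'(4) S S'(3)] group_ring_mult_eq[OF S S'(1) S S'(3)] group_ring_mult_eq[OF S S'(2) S S'(3)] sum.distrib[symmetric])
       (intro sum.cong refl, simp add: algebra_simps)
  show "c \<otimes>\<^bsub>?R\<^esub> (a \<oplus>\<^bsub>?R\<^esub> b) = c \<otimes>\<^bsub>?R\<^esub> a \<oplus>\<^bsub>?R\<^esub> c \<otimes>\<^bsub>?R\<^esub> b"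
    by (rule ext, simp only: add group_ring_mult_eq[OF S S'(3) S S'(4)] group_ring_mult_eq[OF S S'(3) S S'(1)] group_ring_mult_eq[OF S S'(3) S S'(2)] sum.distrib[symmetric])
       (intro sum.cong refl, simp add: algebra_simps)
qed


section \<open>Modules over a ring that need not be commutative\<close>

text \<open>The library locale \<open>module\<close> requires a commutative ring; its record type and its axioms
  are reused here for left modules over an arbitrary ring.\<close>

locale left_module = R?: ring R + M?: abelian_group M
  for R (structure) and M :: "('r, 'm, 'x) module_scheme" (structure) +
  assumes smult_closed [simp, intro]:
      "\<lbrakk>a \<in> carrier R; x \<in> carrier M\<rbrakk> \<Longrightarrow> a \<odot>\<^bsub>M\<^esub> x \<in> carrier M"
    and smult_l_distr:
      "\<lbrakk>a \<in> carrier R; b \<in> carrier R; x \<in> carrier M\<rbrakk> \<Longrightarrow>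
       (a \<oplus> b) \<odot>\<^bsub>M\<^esub> x = a \<odot>\<^bsub>M\<^esub> x \<oplus>\<^bsub>M\<^esub> b \<odot>\<^bsub>M\<^esub> x"
    and smult_r_distr:
      "\<lbrakk>a \<in> carrier R; x \<in> carrier M; y \<in> carrier M\<rbrakk> \<Longrightarrow>
       a \<odot>\<^bsub>M\<^esub> (x \<oplus>\<^bsub>M\<^esub> y) = a \<odot>\<^bsub>M\<^esub> x \<oplus>\<^bsub>M\<^esub> a \<odot>\<^bsub>M\<^esub> y"
    and smult_assoc1:
      "\<lbrakk>a \<in> carrier R; b \<in> carrier R; x \<in> carrier M\<rbrakk> \<Longrightarrow>
       (a \<otimes> b) \<odot>\<^bsub>M\<^esub> x = a \<odot>\<^bsub>M\<^esub> (b \<odot>\<^bsub>M\<^esub> x)"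
    and smult_one [simp]:
      "x \<in> carrier M \<Longrightarrow> \<one> \<odot>\<^bsub>M\<^esub> x = x"

definition linear_maps ::
  "('r, 'y) ring_scheme \<Rightarrow> ('r, 'm, 'x) module_scheme \<Rightarrow> ('r, 'n, 'z) module_scheme \<Rightarrow> ('m \<Rightarrow> 'n) set"
  where
  "linear_maps R M N =
    {f \<in> hom (add_monoid M) (add_monoid N).
       \<forall>a\<in>carrier R. \<forall>x\<in>carrier M. f (a \<odot>\<^bsub>M\<^esub> x) = a \<odot>\<^bsub>N\<^esub> f x}"

definition finitely_generated ::
  "('r, 'y) ring_scheme \<Rightarrow> ('r, 'm, 'x) module_scheme \<Rightarrow> bool" where
  "finitely_generated R M \<longleftrightarrow>
    (\<exists>A. finite A \<and> A \<subseteq> carrier M \<and>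
       (\<forall>x\<in>carrier M. \<exists>c\<in>A \<rightarrow> carrier R. x = (\<Oplus>\<^bsub>M\<^esub>a\<in>A. c a \<odot>\<^bsub>M\<^esub> a)))"

text \<open>Projectivity is the lifting property against surjections \<open>g: N \<rightarrow> N'\<close>. A definition cannot
  quantify over the types of \<open>N\<close> and \<open>N'\<close>. The types chosen here lose nothing: \<open>'p \<Rightarrow> 'r\<close>
  accommodates the free module on the set \<open>carrier P\<close>, and lifting the identity of \<open>P\<close> along
  its canonical surjection onto \<open>P\<close> makes \<open>P\<close> a direct summand of a free module. The lifting
  property for modules of arbitrary types is \<open>projective_lift\<close> below.\<close>

definition projective ::
  "('r, 'y) ring_scheme \<Rightarrow> ('r, 'p) module \<Rightarrow> bool" where
  "projective R P \<longleftrightarrow>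
    (\<forall>(N :: ('r, 'p \<Rightarrow> 'r) module) (N' :: ('r, 'p) module) g f.
       left_module R N \<and> left_module R N' \<and> g \<in> linear_maps R N N' \<and>
       g ` carrier N = carrier N' \<and> f \<in> linear_maps R P N' \<longrightarrow>
       (\<exists>h\<in>linear_maps R P N. \<forall>x\<in>carrier P. g (h x) = f x))"

lemma linear_maps_closed:
  "f \<in> linear_maps R M N \<Longrightarrow> x \<in> carrier M \<Longrightarrow> f x \<in> carrier N"
  by (auto simp: linear_maps_def hom_def)

lemma linear_maps_add:
  "f \<in> linear_maps R M N \<Longrightarrow> x \<in> carrier M \<Longrightarrow> y \<in> carrier M \<Longrightarrow>
    f (x \<oplus>\<^bsub>M\<^esub> y) = f x \<oplus>\<^bsub>N\<^esub> f y"
  by (auto simp: linear_maps_def hom_def)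

lemma linear_maps_smult:
  "f \<in> linear_maps R M N \<Longrightarrow> a \<in> carrier R \<Longrightarrow> x \<in> carrier M \<Longrightarrow>
    f (a \<odot>\<^bsub>M\<^esub> x) = a \<odot>\<^bsub>N\<^esub> f x"
  by (auto simp: linear_maps_def)

lemma linear_mapsI:
  assumes "\<And>x. x \<in> carrier M \<Longrightarrow> f x \<in> carrier N"
    and "\<And>x y. x \<in> carrier M \<Longrightarrow> y \<in> carrier M \<Longrightarrow> f (x \<oplus>\<^bsub>M\<^esub> y) = f x \<oplus>\<^bsub>N\<^esub> f y"
    and "\<And>a x. a \<in> carrier R \<Longrightarrow> x \<in> carrier M \<Longrightarrow> f (a \<odot>\<^bsub>M\<^esub> x) = a \<odot>\<^bsub>N\<^esub> f x"
  shows "f \<in> linear_maps R M N"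
  using assms by (auto simp: linear_maps_def hom_def)

lemma linear_maps_zero:
  assumes "left_module R M" "left_module R N" "f \<in> linear_maps R M N"
  shows "f \<zero>\<^bsub>M\<^esub> = \<zero>\<^bsub>N\<^esub>"
proof -
  interpret M: left_module R M by fact
  interpret N: left_module R N by fact
  have "f \<zero>\<^bsub>M\<^esub> \<oplus>\<^bsub>N\<^esub> f \<zero>\<^bsub>M\<^esub> = f \<zero>\<^bsub>M\<^esub>"
    using linear_maps_add[OF assms(3), of "\<zero>\<^bsub>M\<^esub>" "\<zero>\<^bsub>M\<^esub>"] by simp
  thus ?thesis
    using linear_maps_closed[OF assms(3) M.M.zero_closed] N.M.add.r_cancel_one' by metis
qed

lemma (in left_module) smult_l_null [simp]:
  assumes "x \<in> carrier M" shows "\<zero> \<odot>\<^bsub>M\<^esub> x = \<zero>\<^bsub>M\<^esub>"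
proof -
  have "\<zero> \<odot>\<^bsub>M\<^esub> x \<oplus>\<^bsub>M\<^esub> \<zero> \<odot>\<^bsub>M\<^esub> x = \<zero> \<odot>\<^bsub>M\<^esub> x"
    using smult_l_distr[of \<zero> \<zero> x] assms by simp
  thus ?thesis using assms M.add.r_cancel_one' R.zero_closed smult_closed by metis
qed

lemma (in left_module) smult_r_null [simp]:
  assumes "a \<in> carrier R" shows "a \<odot>\<^bsub>M\<^esub> \<zero>\<^bsub>M\<^esub> = \<zero>\<^bsub>M\<^esub>"
proof -
  have "a \<odot>\<^bsub>M\<^esub> \<zero>\<^bsub>M\<^esub> \<oplus>\<^bsub>M\<^esub> a \<odot>\<^bsub>M\<^esub> \<zero>\<^bsub>M\<^esub> = a \<odot>\<^bsub>M\<^esub> \<zero>\<^bsub>M\<^esub>"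
    using smult_r_distr[of a "\<zero>\<^bsub>M\<^esub>" "\<zero>\<^bsub>M\<^esub>"] assms by simp
  thus ?thesis using assms M.add.r_cancel_one' M.zero_closed smult_closed by metis
qed

lemma (in left_module) finsum_smult:
  "finite A \<Longrightarrow> a \<in> carrier R \<Longrightarrow> u \<in> A \<rightarrow> carrier M \<Longrightarrow>
    a \<odot>\<^bsub>M\<^esub> (\<Oplus>\<^bsub>M\<^esub>i\<in>A. u i) = (\<Oplus>\<^bsub>M\<^esub>i\<in>A. a \<odot>\<^bsub>M\<^esub> u i)"
  by (induction A rule: finite_induct) (auto simp: smult_r_distr Pi_def)

lemma linear_maps_finsum:
  assumes "left_module R M" "left_module R N" "f \<in> linear_maps R M N"
    and "finite A" "u \<in> A \<rightarrow> carrier M"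
  shows "f (\<Oplus>\<^bsub>M\<^esub>i\<in>A. u i) = (\<Oplus>\<^bsub>N\<^esub>i\<in>A. f (u i))"
proof -
  interpret M: left_module R M by fact
  interpret N: left_module R N by fact
  show ?thesis using assms(4,5)
    by (induction A rule: finite_induct)
       (auto simp: linear_maps_zero[OF assms(1-3)] linear_maps_add[OF assms(3)]
          linear_maps_closed[OF assms(3)] Pi_def)
qed

definition free_module_on :: "('r, 'y) ring_scheme \<Rightarrow> 'p set \<Rightarrow> ('r, 'p \<Rightarrow> 'r) module" where
  "free_module_on R S =
    \<lparr> carrier = {c. finite {p. c p \<noteq> \<zero>\<^bsub>R\<^esub>} \<and> {p. c p \<noteq> \<zero>\<^bsub>R\<^esub>} \<subseteq> S \<and> range c \<subseteq> carrier R},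
      mult = (\<lambda>c d p. \<zero>\<^bsub>R\<^esub>), one = (\<lambda>p. \<zero>\<^bsub>R\<^esub>), zero = (\<lambda>p. \<zero>\<^bsub>R\<^esub>),
      add = (\<lambda>c d p. c p \<oplus>\<^bsub>R\<^esub> d p), smult = (\<lambda>a c p. a \<otimes>\<^bsub>R\<^esub> c p) \<rparr>"

lemma left_module_free_module_on:
  assumes "ring R"
  shows "left_module R (free_module_on R S)"
proof -
  interpret ring R by fact
  let ?F = "free_module_on R S"
  have clo: "c p \<in> carrier R" if "c \<in> carrier ?F" for c p
    using that by (auto simp: free_module_on_def)
  show ?thesis
  proof (intro left_module.intro left_module_axioms.intro assms abelian_groupI)
    fix c d assume cd: "c \<in> carrier ?F" "d \<in> carrier ?F"
    have "{p. c p \<oplus>\<^bsub>R\<^esub> d p \<noteq> \<zero>\<^bsub>R\<^esub>} \<subseteq> {p. c p \<noteq> \<zero>\<^bsub>R\<^esub>} \<union> {p. d p \<noteq> \<zero>\<^bsub>R\<^esub>}"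
      by auto
    moreover have "finite ({p. c p \<noteq> \<zero>\<^bsub>R\<^esub>} \<union> {p. d p \<noteq> \<zero>\<^bsub>R\<^esub>})"
        "{p. c p \<noteq> \<zero>\<^bsub>R\<^esub>} \<union> {p. d p \<noteq> \<zero>\<^bsub>R\<^esub>} \<subseteq> S" "\<And>p. c p \<in> carrier R" "\<And>p. d p \<in> carrier R"
      using cd by (auto simp: free_module_on_def)
    ultimately show "c \<oplus>\<^bsub>?F\<^esub> d \<in> carrier ?F"
      using finite_subset[of "{p. c p \<oplus>\<^bsub>R\<^esub> d p \<noteq> \<zero>\<^bsub>R\<^esub>}"] subset_trans[of "{p. c p \<oplus>\<^bsub>R\<^esub> d p \<noteq> \<zero>\<^bsub>R\<^esub>}"]
      by (simp add: free_module_on_def image_subset_iff del: Un_subset_iff finite_Un)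
  next
    fix a c assume a: "a \<in> carrier R" and c: "c \<in> carrier ?F"
    have "{p. a \<otimes>\<^bsub>R\<^esub> c p \<noteq> \<zero>\<^bsub>R\<^esub>} \<subseteq> {p. c p \<noteq> \<zero>\<^bsub>R\<^esub>}"
      using a by auto
    moreover have "finite {p. c p \<noteq> \<zero>\<^bsub>R\<^esub>}" "{p. c p \<noteq> \<zero>\<^bsub>R\<^esub>} \<subseteq> S" "\<And>p. c p \<in> carrier R"
      using c by (auto simp: free_module_on_def)
    ultimately show "a \<odot>\<^bsub>?F\<^esub> c \<in> carrier ?F" using a
      by (simp add: free_module_on_def image_subset_iff) (meson finite_subset subset_trans)
  next
    fix c assume c: "c \<in> carrier ?F"
    have eq: "\<ominus>\<^bsub>R\<^esub> c p = \<zero>\<^bsub>R\<^esub> \<longleftrightarrow> c p = \<zero>\<^bsub>R\<^esub>" for p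
      using clo[OF c, of p] by (metis minus_minus minus_zero)
    show "\<exists>d\<in>carrier ?F. d \<oplus>\<^bsub>?F\<^esub> c = \<zero>\<^bsub>?F\<^esub>"
      using c clo[OF c] eq
      by (intro bexI[of _ "\<lambda>p. \<ominus>\<^bsub>R\<^esub> c p"])
         (auto simp: free_module_on_def l_neg image_subset_iff)
  qed (auto simp: free_module_on_def a_ac l_distr r_distr m_assoc image_subset_iff
        intro!: ext)
qed

definition free_eval ::
  "('r, 'y) ring_scheme \<Rightarrow> ('r, 'n, 'x) module_scheme \<Rightarrow> ('p \<Rightarrow> 'n) \<Rightarrow> ('p \<Rightarrow> 'r) \<Rightarrow> 'n" where
  "free_eval R N n c = (\<Oplus>\<^bsub>N\<^esub>p\<in>{p. c p \<noteq> \<zero>\<^bsub>R\<^esub>}. c p \<odot>\<^bsub>N\<^esub> n p)"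

lemma free_eval_eq:
  assumes "left_module R N" "n \<in> S \<rightarrow> carrier N" "c \<in> carrier (free_module_on R S)"
    and A: "finite A" "{p. c p \<noteq> \<zero>\<^bsub>R\<^esub>} \<subseteq> A" "A \<subseteq> S"
  shows "free_eval R N n c = (\<Oplus>\<^bsub>N\<^esub>p\<in>A. c p \<odot>\<^bsub>N\<^esub> n p)"
proof -
  interpret N: left_module R N by fact
  have c: "c p \<in> carrier R" for p using assms(3) by (auto simp: free_module_on_def)
  have n: "n p \<in> carrier N" if "p \<in> A" for p using that assms(2) A(3) by blast
  show ?thesis unfolding free_eval_def
    by (rule N.M.add.finprod_mono_neutral_cong_left) (use A c n in auto)
qed

lemma free_eval_linear:
  assumes "left_module R N" "n \<in> S \<rightarrow> carrier N"
  shows "free_eval R N n \<in> linear_maps R (free_module_on R S) N"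
proof -
  interpret N: left_module R N by fact
  let ?F = "free_module_on R S"
  interpret F: left_module R ?F by (rule left_module_free_module_on) (rule N.R.ring_axioms)
  have clo: "c p \<in> carrier R" if "c \<in> carrier ?F" for c p
    using that by (auto simp: free_module_on_def)
  have supp: "finite {p. c p \<noteq> \<zero>\<^bsub>R\<^esub>}" "{p. c p \<noteq> \<zero>\<^bsub>R\<^esub>} \<subseteq> S" if "c \<in> carrier ?F" for c
    using that by (auto simp: free_module_on_def)
  have n: "n p \<in> carrier N" if "p \<in> S" for p using that assms(2) by blast
  show ?thesis
  proof (rule linear_mapsI)
    fix c assume c: "c \<in> carrier ?F"
    show "free_eval R N n c \<in> carrier N" unfolding free_eval_def
      by (rule N.M.finsum_closed) (use supp[OF c] clo[OF c] n in auto)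
  next
    fix c d assume cd: "c \<in> carrier ?F" "d \<in> carrier ?F"
    define A where "A = {p. c p \<noteq> \<zero>\<^bsub>R\<^esub>} \<union> {p. d p \<noteq> \<zero>\<^bsub>R\<^esub>}"
    have A: "finite A" "A \<subseteq> S" "{p. c p \<noteq> \<zero>\<^bsub>R\<^esub>} \<subseteq> A" "{p. d p \<noteq> \<zero>\<^bsub>R\<^esub>} \<subseteq> A"
      using supp cd by (auto simp: A_def)
    have s: "(c \<oplus>\<^bsub>?F\<^esub> d) p = c p \<oplus>\<^bsub>R\<^esub> d p" for p by (simp add: free_module_on_def)
    have A': "{p. (c \<oplus>\<^bsub>?F\<^esub> d) p \<noteq> \<zero>\<^bsub>R\<^esub>} \<subseteq> A" by (auto simp: A_def s)
    have "free_eval R N n (c \<oplus>\<^bsub>?F\<^esub> d) = (\<Oplus>\<^bsub>N\<^esub>p\<in>A. (c \<oplus>\<^bsub>?F\<^esub> d) p \<odot>\<^bsub>N\<^esub> n p)"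
      by (rule free_eval_eq[OF assms F.M.a_closed[OF cd] A(1) A' A(2)])
    also have "\<dots> = (\<Oplus>\<^bsub>N\<^esub>p\<in>A. c p \<odot>\<^bsub>N\<^esub> n p \<oplus>\<^bsub>N\<^esub> d p \<odot>\<^bsub>N\<^esub> n p)"
      by (rule N.M.finsum_cong') (use A n clo cd in \<open>auto simp: s N.smult_l_distr subset_iff\<close>)
    also have "\<dots> = (\<Oplus>\<^bsub>N\<^esub>p\<in>A. c p \<odot>\<^bsub>N\<^esub> n p) \<oplus>\<^bsub>N\<^esub> (\<Oplus>\<^bsub>N\<^esub>p\<in>A. d p \<odot>\<^bsub>N\<^esub> n p)"
      by (rule N.M.finsum_addf) (use A n clo cd in auto)
    also have "\<dots> = free_eval R N n c \<oplus>\<^bsub>N\<^esub> free_eval R N n d"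
      using free_eval_eq[OF assms cd(1) A(1,3,2)] free_eval_eq[OF assms cd(2) A(1,4,2)] by simp
    finally show "free_eval R N n (c \<oplus>\<^bsub>?F\<^esub> d) = free_eval R N n c \<oplus>\<^bsub>N\<^esub> free_eval R N n d" .
  next
    fix a c assume a: "a \<in> carrier R" and c: "c \<in> carrier ?F"
    define A where "A = {p. c p \<noteq> \<zero>\<^bsub>R\<^esub>}"
    have A: "finite A" "A \<subseteq> S" "{p. c p \<noteq> \<zero>\<^bsub>R\<^esub>} \<subseteq> A"
      using supp c by (auto simp: A_def)
    have s: "(a \<odot>\<^bsub>?F\<^esub> c) p = a \<otimes>\<^bsub>R\<^esub> c p" for p by (simp add: free_module_on_def)
    have A': "{p. (a \<odot>\<^bsub>?F\<^esub> c) p \<noteq> \<zero>\<^bsub>R\<^esub>} \<subseteq> A" using a by (auto simp: A_def s)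
    have "free_eval R N n (a \<odot>\<^bsub>?F\<^esub> c) = (\<Oplus>\<^bsub>N\<^esub>p\<in>A. (a \<odot>\<^bsub>?F\<^esub> c) p \<odot>\<^bsub>N\<^esub> n p)"
      by (rule free_eval_eq[OF assms F.smult_closed[OF a c] A(1) A' A(2)])
    also have "\<dots> = (\<Oplus>\<^bsub>N\<^esub>p\<in>A. a \<odot>\<^bsub>N\<^esub> (c p \<odot>\<^bsub>N\<^esub> n p))"
      by (rule N.M.finsum_cong') (use A n clo c a in \<open>auto simp: s N.smult_assoc1 subset_iff\<close>)
    also have "\<dots> = a \<odot>\<^bsub>N\<^esub> free_eval R N n c" unfolding free_eval_def A_def[symmetric]
      by (rule N.finsum_smult[symmetric]) (use A n clo c a in auto)
    finally show "free_eval R N n (a \<odot>\<^bsub>?F\<^esub> c) = a \<odot>\<^bsub>N\<^esub> free_eval R N n c" .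
  qed
qed

lemma projective_lift:
  fixes P :: "('r, 'p) module"
    and N :: "('r, 'n, 'x) module_scheme" and N' :: "('r, 'k, 'z) module_scheme"
  assumes P: "left_module R P" "projective R P"
    and N: "left_module R N" "left_module R N'"
    and g: "g \<in> linear_maps R N N'" "g ` carrier N = carrier N'"
    and f: "f \<in> linear_maps R P N'"
  shows "\<exists>h\<in>linear_maps R P N. \<forall>x\<in>carrier P. g (h x) = f x"
proof -
  interpret P: left_module R P by fact
  interpret N: left_module R N by fact
  interpret N': left_module R N' by fact
  let ?F = "free_module_on R (carrier P)"
  have F: "left_module R ?F" by (rule left_module_free_module_on) (rule P.R.ring_axioms)
  let ?e = "free_eval R P (\<lambda>p. p)"
  have e: "?e \<in> linear_maps R ?F P"
    by (rule free_eval_linear[OF P(1)]) simp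
  have "carrier P \<subseteq> ?e ` carrier ?F"
  proof
    fix p assume p: "p \<in> carrier P"
    define c where "c = (\<lambda>q. if q = p then \<one>\<^bsub>R\<^esub> else \<zero>\<^bsub>R\<^esub>)"
    have c: "c \<in> carrier ?F" "{q. c q \<noteq> \<zero>\<^bsub>R\<^esub>} \<subseteq> {p}" using p by (auto simp: c_def free_module_on_def)
    have "?e c = (\<Oplus>\<^bsub>P\<^esub>q\<in>{p}. c q \<odot>\<^bsub>P\<^esub> q)"
      by (rule free_eval_eq[OF P(1) _ c(1) _ c(2)]) (use p in auto)
    also have "\<dots> = p" using p by (simp add: c_def)
    finally show "p \<in> ?e ` carrier ?F" using c(1) by (metis image_eqI)
  qed
  hence surj: "?e ` carrier ?F = carrier P" using linear_maps_closed[OF e] by blast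
  have "(\<lambda>x. x) \<in> linear_maps R P P" by (rule linear_mapsI) auto
  then obtain s where s: "s \<in> linear_maps R P ?F" "\<forall>x\<in>carrier P. ?e (s x) = x"
    using P(2)[unfolded projective_def, rule_format, of ?F P ?e "\<lambda>x. x"] F P(1) e surj by blast
  have "\<forall>p\<in>carrier P. \<exists>n\<in>carrier N. g n = f p"
    using linear_maps_closed[OF f] g(2) by (metis imageE)
  then obtain n where n: "\<And>p. p \<in> carrier P \<Longrightarrow> n p \<in> carrier N"
      "\<And>p. p \<in> carrier P \<Longrightarrow> g (n p) = f p" by metis
  let ?t = "free_eval R N n"
  have t: "?t \<in> linear_maps R ?F N" by (rule free_eval_linear[OF N(1)]) (use n in auto)
  have gt: "g (?t c) = f (?e c)" if c: "c \<in> carrier ?F" for c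
  proof -
    define A where "A = {p. c p \<noteq> \<zero>\<^bsub>R\<^esub>}"
    have A: "finite A" "A \<subseteq> carrier P" "\<And>p. c p \<in> carrier R"
      using c by (auto simp: A_def free_module_on_def)
    have "g (?t c) = (\<Oplus>\<^bsub>N'\<^esub>p\<in>A. g (c p \<odot>\<^bsub>N\<^esub> n p))"
      unfolding free_eval_def A_def[symmetric]
      by (rule linear_maps_finsum[OF N g(1) A(1)]) (use A n in auto)
    also have "\<dots> = (\<Oplus>\<^bsub>N'\<^esub>p\<in>A. f (c p \<odot>\<^bsub>P\<^esub> p))"
      by (rule N'.M.finsum_cong')
         (use A n linear_maps_closed[OF f] in
           \<open>auto simp: linear_maps_smult[OF g(1)] linear_maps_smult[OF f] subset_iff\<close>)
    also have "\<dots> = f (?e c)"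
      unfolding free_eval_def A_def[symmetric]
      by (rule linear_maps_finsum[OF P(1) N(2) f A(1), symmetric]) (use A in auto)
    finally show ?thesis .
  qed
  show ?thesis
  proof (intro bexI ballI)
    show "(\<lambda>x. ?t (s x)) \<in> linear_maps R P N"
      by (rule linear_mapsI)
         (simp_all add: linear_maps_closed[OF t] linear_maps_closed[OF s(1)]
            linear_maps_add[OF t] linear_maps_add[OF s(1)]
            linear_maps_smult[OF t] linear_maps_smult[OF s(1)])
    fix x assume "x \<in> carrier P"
    thus "g (?t (s x)) = f x" using gt linear_maps_closed[OF s(1)] s(2) by simp
  qed
qed

definition finite_basis ::
  "('r, 'y) ring_scheme \<Rightarrow> ('r, 'f, 'x) module_scheme \<Rightarrow> 'i set \<Rightarrow> ('i \<Rightarrow> 'f) \<Rightarrow> bool" where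
  "finite_basis R F I \<alpha> \<longleftrightarrow>
    finite I \<and> \<alpha> \<in> I \<rightarrow> carrier F \<and>
    (\<forall>x\<in>carrier F. \<exists>!c. c \<in> I \<rightarrow>\<^sub>E carrier R \<and> x = (\<Oplus>\<^bsub>F\<^esub>i\<in>I. c i \<odot>\<^bsub>F\<^esub> \<alpha> i))"


section \<open>Resolutions and finiteness properties\<close>

text \<open>An exact sequence \<open>P n \<rightarrow> \<dots> \<rightarrow> P 0 \<rightarrow> M \<rightarrow> 0\<close> with differentials \<open>\<phi> i: P i \<rightarrow> P (i - 1)\<close>
  for \<open>1 \<le> i \<le> n\<close> and augmentation \<open>\<epsilon>: P 0 \<rightarrow> M\<close>. The elements of the finitely many modules
  \<open>P i\<close> share one type, which is no restriction, since disjoint unions of types exist.\<close>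

definition FP_resolution ::
  "('r, 'y) ring_scheme \<Rightarrow> nat \<Rightarrow> ('r, 'm, 'x) module_scheme \<Rightarrow>
   (nat \<Rightarrow> ('r, 'p) module) \<Rightarrow> (nat \<Rightarrow> 'p \<Rightarrow> 'p) \<Rightarrow> ('p \<Rightarrow> 'm) \<Rightarrow> bool" where
  "FP_resolution R n M P \<phi> \<epsilon> \<longleftrightarrow>
    (\<forall>i\<le>n. left_module R (P i) \<and> finitely_generated R (P i) \<and> projective R (P i)) \<and>
    (\<forall>i<n. \<phi> (Suc i) \<in> linear_maps R (P (Suc i)) (P i)) \<and>
    \<epsilon> \<in> linear_maps R (P 0) M \<and>
    \<epsilon> ` carrier (P 0) = carrier M \<and>
    (0 < n \<longrightarrow> \<phi> 1 ` carrier (P 1) = a_kernel (P 0) M \<epsilon>) \<and>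
    (\<forall>i. Suc i < n \<longrightarrow>
       \<phi> (Suc (Suc i)) ` carrier (P (Suc (Suc i))) = a_kernel (P (Suc i)) (P i) (\<phi> (Suc i)))"

text \<open>The existential quantifier needs a type for the elements of the \<open>P i\<close>. The type
  \<open>nat \<Rightarrow> 'r\<close> contains all finite powers of \<open>R\<close>, and every finitely generated projective module
  is isomorphic to a submodule of one of these.\<close>

definition type_FP ::
  "('r, 'y) ring_scheme \<Rightarrow> nat \<Rightarrow> ('r, 'm, 'x) module_scheme \<Rightarrow> bool" where
  "type_FP R n M \<longleftrightarrow>
    (\<exists>(P :: nat \<Rightarrow> ('r, nat \<Rightarrow> 'r) module) \<phi> \<epsilon>. FP_resolution R n M P \<phi> \<epsilon>)"


section \<open>Filling norms\<close>

definition int_coords ::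
  "('a, 'x) ring_scheme \<Rightarrow> 'j set \<Rightarrow> ('j \<Rightarrow> 'a) \<Rightarrow> 'a \<Rightarrow> 'j \<Rightarrow> int" where
  "int_coords A J b x =
    (THE c. finite {j. c j \<noteq> 0} \<and> {j. c j \<noteq> 0} \<subseteq> J \<and>
       x = (\<Oplus>\<^bsub>A\<^esub>j\<in>{j. c j \<noteq> 0}. [c j] \<cdot>\<^bsub>A\<^esub> b j))"

text \<open>The \<open>\<ell>\<^sub>1\<close>-norm on the free abelian group \<open>A\<close> with \<open>\<int>\<close>-basis \<open>(b j)\<close>, \<open>j \<in> J\<close>.\<close>

definition l1_norm ::
  "('a, 'x) ring_scheme \<Rightarrow> 'j set \<Rightarrow> ('j \<Rightarrow> 'a) \<Rightarrow> 'a \<Rightarrow> nat" where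
  "l1_norm A J b x =
    (\<Sum>j | int_coords A J b x j \<noteq> 0. nat \<bar>int_coords A J b x j\<bar>)"

definition free_norm ::
  "('g, 'y) monoid_scheme \<Rightarrow> ('g \<Rightarrow> int, 'f, 'x) module_scheme \<Rightarrow> 'i set \<Rightarrow> ('i \<Rightarrow> 'f) \<Rightarrow> 'f \<Rightarrow> nat"
  where
  "free_norm G F I \<alpha> =
    l1_norm F (carrier G \<times> I) (\<lambda>(g, i). group_ring_of g \<odot>\<^bsub>F\<^esub> \<alpha> i)"

definition induced_norm ::
  "('b, 'x) partial_object_scheme \<Rightarrow> ('b \<Rightarrow> nat) \<Rightarrow> ('b \<Rightarrow> 'a) \<Rightarrow> 'a \<Rightarrow> nat" where
  "induced_norm F \<nu> \<eta> m = (LEAST n. \<exists>x\<in>carrier F. \<eta> x = m \<and> \<nu> x = n)"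

text \<open>The type arguments are those of the elements of the free module \<open>F\<close> and of the indices
  of its basis.\<close>

definition filling_norm ::
  "'f itself \<Rightarrow> 'i itself \<Rightarrow> ('g, 'y) monoid_scheme \<Rightarrow> ('g \<Rightarrow> int, 'n, 'x) module_scheme \<Rightarrow>
   ('n \<Rightarrow> nat) \<Rightarrow> bool" where
  "filling_norm _ _ G N \<nu> \<longleftrightarrow>
    (\<exists>(F :: ('g \<Rightarrow> int, 'f) module) (I :: 'i set) \<alpha> \<eta>.
       left_module (group_ring G) F \<and> finite_basis (group_ring G) F I \<alpha> \<and>
       \<eta> \<in> linear_maps (group_ring G) F N \<and> \<eta> ` carrier F = carrier N \<and>
       (\<forall>m\<in>carrier N. \<nu> m = induced_norm F (free_norm G F I \<alpha>) \<eta> m))"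


section \<open>Filling functions and their growth\<close>

text \<open>The \<open>(d + 1)\<close>-filling function computed from \<open>P\<close>, \<open>\<phi>\<close> and the norms \<open>\<nu>'\<close> on
  \<open>P (d + 1)\<close> and \<open>\<nu>\<close> on \<open>P d\<close>, for \<open>d > 0\<close>.\<close>

definition filling_function ::
  "nat \<Rightarrow> (nat \<Rightarrow> ('r, 'p) module) \<Rightarrow> (nat \<Rightarrow> 'p \<Rightarrow> 'p) \<Rightarrow> ('p \<Rightarrow> nat) \<Rightarrow> ('p \<Rightarrow> nat) \<Rightarrow> nat \<Rightarrow> enat"
  where
  "filling_function d P \<phi> \<nu>' \<nu> k =
    (SUP x\<in>{x \<in> a_kernel (P d) (P (d - 1)) (\<phi> d). \<nu> x \<le> k}.
       enat (induced_norm (P (d + 1)) \<nu>' (\<phi> (d + 1)) x))"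

definition growth_le :: "(nat \<Rightarrow> nat) \<Rightarrow> (nat \<Rightarrow> nat) \<Rightarrow> bool" where
  "growth_le f g \<longleftrightarrow> (\<exists>C>0. \<forall>n. f n \<le> C * g (C * n + C) + C * n + C)"

definition growth_equiv :: "(nat \<Rightarrow> nat) \<Rightarrow> (nat \<Rightarrow> nat) \<Rightarrow> bool" where
  "growth_equiv f g \<longleftrightarrow> growth_le f g \<and> growth_le g f"

end

theory Submission
  imports Defs
begin

text \<open>A filling norm is, by construction, a word norm: the norm of an element is the least number of
  summands \<open>\<plusminus> g \<cdot> a\<close>, with \<open>g\<close> in the group and \<open>a\<close> in a fixed finite set, that express it. Such a
  norm is invariant under translation, and it dominates every other invariant norm up to a
  constant factor; in particular linear maps are bounded (\<open>linear_map_bounded\<close>).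

  Finiteness is a matter of connectedness. The module \<open>P (d - 1)\<close> embeds in a free module, so the
  boundary of a summand \<open>\<plusminus> g \<cdot> a\<close> has finitely many cells, and a given cell occurs in the boundary of
  finitely many summands. A cycle of norm at most \<open>k\<close> decomposes into at most \<open>k\<close> connected cycles,
  because summands without common boundary cells cannot cancel each other. Up to translation
  there are only finitely many connected cycles of at most \<open>k\<close> summands. The least norm of a filling
  is subadditive and invariant under translation, so it is bounded on the cycles of norm at most
  \<open>k\<close>. The lemma \<open>short_cycles_bounded\<close> carries this out by induction, without mentioning
  connected components.

  Independence of the choices follows from the comparison of projective resolutions: the
  identity of the module lifts to chain maps in both directions whose composite is homotopic to
  the identity (\<open>resolution_comparison_maps\<close>). Chain maps and homotopies are linear,
  hence bounded, and transporting an optimal filling from one resolution to the other compares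
  the two filling functions (\<open>filling_function_growth_le\<close>).\<close>

section \<open>Finite sums in left modules\<close>

text \<open>Lists are used because a norm below counts summands with repetition, and because a list can
  be split by filtering without changing its sum.\<close>

definition list_sum :: "('a, 'x) ring_scheme \<Rightarrow> 'a list \<Rightarrow> 'a" where
  "list_sum N L = foldr (\<lambda>x s. x \<oplus>\<^bsub>N\<^esub> s) L \<zero>\<^bsub>N\<^esub>"

lemma list_sum_simps [simp]:
  "list_sum N [] = \<zero>\<^bsub>N\<^esub>" "list_sum N (x # L) = x \<oplus>\<^bsub>N\<^esub> list_sum N L"
  by (simp_all add: list_sum_def)

lemma (in abelian_group) list_sum_closed [simp, intro]:
  "set L \<subseteq> carrier G \<Longrightarrow> list_sum G L \<in> carrier G"
  by (induction L) auto

lemma (in abelian_group) list_sum_append: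
  "set L \<subseteq> carrier G \<Longrightarrow> set L' \<subseteq> carrier G \<Longrightarrow>
    list_sum G (L @ L') = list_sum G L \<oplus> list_sum G L'"
  by (induction L) (auto simp: a_assoc)

lemma (in abelian_group) list_sum_partition:
  "set L \<subseteq> carrier G \<Longrightarrow>
    list_sum G L = list_sum G (filter Q L) \<oplus> list_sum G (filter (\<lambda>x. \<not> Q x) L)"
proof (induction L)
  case (Cons x L)
  have "set (filter Q L) \<subseteq> carrier G" "set (filter (\<lambda>x. \<not> Q x) L) \<subseteq> carrier G"
    using Cons.prems by auto
  thus ?case using Cons by (auto simp: a_ac)
qed simp

lemma (in abelian_group) list_sum_replicate:
  assumes "a \<in> carrier G"
  shows "list_sum G (replicate n a) = [n] \<cdot> a"
  by (induction n) (use assms in \<open>simp_all add: add.nat_pow_Suc2[simplified]\<close>)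

lemma (in abelian_group) int_multiple_list:
  assumes "a \<in> carrier G"
  obtains L where "set L \<subseteq> {a, \<ominus> a}" "length L = nat \<bar>n\<bar>" "list_sum G L = [(n::int)] \<cdot> a"
proof (cases "n \<ge> 0")
  case True
  show ?thesis
    by (rule that[of "replicate (nat n) a"])
       (use True assms in \<open>auto simp: list_sum_replicate add_pow_int_ge\<close>)
next
  case False
  show ?thesis
    by (rule that[of "replicate (nat (- n)) (\<ominus> a)"])
       (use False assms in \<open>auto simp: list_sum_replicate add_pow_int_lt add.nat_pow_inv\<close>)
qed

lemma linear_maps_list_sum:
  assumes "left_module R M" "left_module R N" "f \<in> linear_maps R M N" "set L \<subseteq> carrier M"
  shows "f (list_sum M L) = list_sum N (map f L)"
proof -
  interpret M: left_module R M by fact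
  show ?thesis using assms(4)
    by (induction L) (simp_all add: linear_maps_zero[OF assms(1-3)] linear_maps_add[OF assms(3)])
qed

lemma linear_maps_neg:
  assumes "left_module R M" "left_module R N" "f \<in> linear_maps R M N" "x \<in> carrier M"
  shows "f (\<ominus>\<^bsub>M\<^esub> x) = \<ominus>\<^bsub>N\<^esub> f x"
proof -
  interpret M: left_module R M by fact
  interpret N: left_module R N by fact
  have "f (\<ominus>\<^bsub>M\<^esub> x) \<oplus>\<^bsub>N\<^esub> f x = \<zero>\<^bsub>N\<^esub>"
    using linear_maps_add[OF assms(3), of "\<ominus>\<^bsub>M\<^esub> x" x] assms(4)
      linear_maps_zero[OF assms(1-3)] by (simp add: M.M.l_neg)
  thus ?thesis
    using assms(4) by (intro N.M.minus_equality[symmetric]) (auto intro: linear_maps_closed[OF assms(3)])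
qed

lemma (in left_module) smult_neg:
  assumes "a \<in> carrier R" "x \<in> carrier M"
  shows "a \<odot>\<^bsub>M\<^esub> (\<ominus>\<^bsub>M\<^esub> x) = \<ominus>\<^bsub>M\<^esub> (a \<odot>\<^bsub>M\<^esub> x)"
proof -
  have "a \<odot>\<^bsub>M\<^esub> (\<ominus>\<^bsub>M\<^esub> x) \<oplus>\<^bsub>M\<^esub> a \<odot>\<^bsub>M\<^esub> x = \<zero>\<^bsub>M\<^esub>"
    using assms by (simp add: smult_r_distr[symmetric] M.l_neg)
  thus ?thesis using assms by (intro M.minus_equality[symmetric]) auto
qed

lemma (in left_module) smult_neg_left:
  assumes "a \<in> carrier R" "x \<in> carrier M"
  shows "(\<ominus> a) \<odot>\<^bsub>M\<^esub> x = \<ominus>\<^bsub>M\<^esub> (a \<odot>\<^bsub>M\<^esub> x)"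
proof -
  have "(\<ominus> a) \<odot>\<^bsub>M\<^esub> x \<oplus>\<^bsub>M\<^esub> a \<odot>\<^bsub>M\<^esub> x = \<zero>\<^bsub>M\<^esub>"
    using assms by (simp add: smult_l_distr[symmetric] R.l_neg)
  thus ?thesis using assms by (intro M.minus_equality[symmetric]) auto
qed

lemma (in left_module) smult_list_sum:
  "a \<in> carrier R \<Longrightarrow> set L \<subseteq> carrier M \<Longrightarrow>
    a \<odot>\<^bsub>M\<^esub> list_sum M L = list_sum M (map (\<lambda>x. a \<odot>\<^bsub>M\<^esub> x) L)"
  by (induction L) (auto simp: smult_r_distr)

section \<open>Group elements in the integral group ring\<close>

lemma group_ring_carrier_iff:
  "a \<in> carrier (group_ring G) \<longleftrightarrow> finite {g. a g \<noteq> 0} \<and> {g. a g \<noteq> 0} \<subseteq> carrier G"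
  by (simp add: group_ring_def)

lemma group_ring_simps [simp]:
  "(a \<oplus>\<^bsub>group_ring G\<^esub> b) x = a x + b x" "\<zero>\<^bsub>group_ring G\<^esub> x = 0"
  by (simp_all add: group_ring_def)

lemma group_ring_of_closed [simp]: "g \<in> carrier G \<Longrightarrow> group_ring_of g \<in> carrier (group_ring G)"
  by (simp add: group_ring_def group_ring_of_def)

lemma group_ring_of_one: "group_ring_of \<one>\<^bsub>G\<^esub> = \<one>\<^bsub>group_ring G\<^esub>"
  by (simp add: group_ring_def group_ring_of_def)

text \<open>Left multiplication by a group element translates coefficient functions. This is what makes
  the \<open>\<ell>\<^sub>1\<close>-norm invariant, and it tells which translates of an element have a prescribed group
  element in their support.\<close>

lemma (in group) group_ring_of_mult_left:
  assumes "g \<in> carrier G" "r \<in> carrier (group_ring G)" "x \<in> carrier G"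
  shows "(group_ring_of g \<otimes>\<^bsub>group_ring G\<^esub> r) x = r (inv g \<otimes> x)"
proof -
  have *: "finite {h. r h \<noteq> 0}" "{h. r h \<noteq> 0} \<subseteq> carrier G" using assms(2) by (auto simp: group_ring_def)
  have "(group_ring_of g \<otimes>\<^bsub>group_ring G\<^esub> r) x =
      (\<Sum>h | r h \<noteq> 0. if g \<otimes> h = x then r h else 0)"
    by (subst group_ring_mult_eq[of "{g}" _ "{h. r h \<noteq> 0}"])
       (use * in \<open>auto simp: group_ring_of_def intro!: sum.cong\<close>)
  also have "\<dots> = (\<Sum>h | r h \<noteq> 0. if h = inv g \<otimes> x then r h else 0)"
    by (intro sum.cong refl) (use * assms in \<open>auto simp: m_assoc[symmetric]\<close>)
  also have "\<dots> = r (inv g \<otimes> x)" using * by simp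
  finally show ?thesis .
qed

lemma (in group) group_ring_of_mult:
  assumes "g \<in> carrier G" "h \<in> carrier G"
  shows "group_ring_of g \<otimes>\<^bsub>group_ring G\<^esub> group_ring_of h = group_ring_of (g \<otimes> h)"
proof
  fix x
  show "(group_ring_of g \<otimes>\<^bsub>group_ring G\<^esub> group_ring_of h) x = group_ring_of (g \<otimes> h) x"
    by (subst group_ring_mult_eq[of "{g}" _ "{h}"])
       (use assms in \<open>auto simp: group_ring_of_def\<close>)
qed

locale group_module = group G + left_module "group_ring G" N
  for G :: "('g, 'y) monoid_scheme" (structure) and N :: "('g \<Rightarrow> int, 'n, 'x) module_scheme"
begin

abbreviation act :: "'g \<Rightarrow> 'n \<Rightarrow> 'n" where "act g x \<equiv> group_ring_of g \<odot>\<^bsub>N\<^esub> x"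

lemma act_closed: "g \<in> carrier G \<Longrightarrow> x \<in> carrier N \<Longrightarrow> act g x \<in> carrier N"
  by simp

lemma act_act:
  "g \<in> carrier G \<Longrightarrow> h \<in> carrier G \<Longrightarrow> x \<in> carrier N \<Longrightarrow> act g (act h x) = act (g \<otimes> h) x"
  by (simp add: smult_assoc1[symmetric] group_ring_of_mult)

lemma act_one: "x \<in> carrier N \<Longrightarrow> act \<one> x = x"
  by (simp add: group_ring_of_one)

text \<open>The link between the two descriptions of a free module: a single group ring coefficient
  acts as an integer multiple of a translate.\<close>

lemma int_multiple_act:
  assumes "g \<in> carrier G" "x \<in> carrier N"
  shows "(\<lambda>h. if h = g then n else 0) \<odot>\<^bsub>N\<^esub> x = [(n::int)] \<cdot>\<^bsub>N\<^esub> act g x"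
proof -
  let ?s = "\<lambda>n h. if h = g then (n::int) else 0"
  have s: "?s n \<in> carrier (group_ring G)" for n using assms(1) by (auto simp: group_ring_def)
  have step: "?s (n + 1) \<odot>\<^bsub>N\<^esub> x = ?s n \<odot>\<^bsub>N\<^esub> x \<oplus>\<^bsub>N\<^esub> act g x" for n
  proof -
    have "?s (n + 1) = ?s n \<oplus>\<^bsub>group_ring G\<^esub> group_ring_of g"
      by (rule ext) (simp add: group_ring_of_def)
    thus ?thesis using assms s by (simp add: smult_l_distr)
  qed
  have pow: "[(n + 1)] \<cdot>\<^bsub>N\<^esub> act g x = [n] \<cdot>\<^bsub>N\<^esub> act g x \<oplus>\<^bsub>N\<^esub> act g x" for n :: int
    using M.add.int_pow_mult[of "act g x" n 1] assms by simp
  have zero: "?s 0 = \<zero>\<^bsub>group_ring G\<^esub>" by (rule ext) simp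
  show ?thesis
  proof (induction n rule: int_induct[where k = 0])
    case base
    show ?case using assms unfolding zero by (simp add: add_pow_int_ge)
  next
    case (step1 n)
    thus ?case by (simp only: step pow)
  next
    case (step2 n)
    have "?s (n - 1) \<odot>\<^bsub>N\<^esub> x \<oplus>\<^bsub>N\<^esub> act g x = [(n - 1)] \<cdot>\<^bsub>N\<^esub> act g x \<oplus>\<^bsub>N\<^esub> act g x"
      using step2.IH step[of "n - 1"] pow[of "n - 1"] unfolding diff_add_cancel by simp
    thus ?case using assms s M.add.right_cancel M.add.int_pow_closed by (metis act_closed smult_closed)
  qed
qed

end

section \<open>The norm of a free module\<close>

text \<open>The letters of the words that represent elements of \<open>N\<close>. Closing the translates of \<open>A\<close> under
  negation allows an element of norm \<open>n\<close> to be a plain sum of \<open>n\<close> letters, without coefficients.\<close>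

definition signed_orbits ::
  "('g, 'y) monoid_scheme \<Rightarrow> ('g \<Rightarrow> int, 'n, 'x) module_scheme \<Rightarrow> 'n set \<Rightarrow> 'n set" where
  "signed_orbits G N A =
    (\<Union>g\<in>carrier G. \<Union>a\<in>A. {group_ring_of g \<odot>\<^bsub>N\<^esub> a, \<ominus>\<^bsub>N\<^esub> (group_ring_of g \<odot>\<^bsub>N\<^esub> a)})"

text \<open>The properties of filling norms that survive passing to induced norms. They are required only
  on \<open>K\<close>, since the norm of fillings is meaningful only for boundaries. The inequalities for
  negation and translation are equalities when \<open>K\<close> is a submodule.\<close>

definition invariant_norm_on ::
  "('g, 'y) monoid_scheme \<Rightarrow> ('g \<Rightarrow> int, 'n, 'x) module_scheme \<Rightarrow> 'n set \<Rightarrow> ('n \<Rightarrow> nat) \<Rightarrow> bool" where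
  "invariant_norm_on G N K \<nu> \<longleftrightarrow>
    \<nu> \<zero>\<^bsub>N\<^esub> = 0 \<and>
    (\<forall>x\<in>K. \<forall>y\<in>K. \<nu> (x \<oplus>\<^bsub>N\<^esub> y) \<le> \<nu> x + \<nu> y) \<and>
    (\<forall>x\<in>K. \<nu> (\<ominus>\<^bsub>N\<^esub> x) \<le> \<nu> x) \<and>
    (\<forall>g\<in>carrier G. \<forall>x\<in>K. \<nu> (group_ring_of g \<odot>\<^bsub>N\<^esub> x) \<le> \<nu> x)"

definition group_ring_l1_norm :: "('g \<Rightarrow> int) \<Rightarrow> nat" where
  "group_ring_l1_norm r = (\<Sum>g | r g \<noteq> 0. nat \<bar>r g\<bar>)"

lemma group_ring_l1_norm_eq:
  assumes "finite T" "{g. r g \<noteq> 0} \<subseteq> T"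
  shows "group_ring_l1_norm r = (\<Sum>g\<in>T. nat \<bar>r g\<bar>)"
  unfolding group_ring_l1_norm_def by (rule sum.mono_neutral_left) (use assms in auto)

lemma group_ring_l1_norm_add:
  assumes "r \<in> carrier (group_ring G)" "s \<in> carrier (group_ring G)"
  shows "group_ring_l1_norm (r \<oplus>\<^bsub>group_ring G\<^esub> s) \<le> group_ring_l1_norm r + group_ring_l1_norm s"
proof -
  define T where "T = {g. r g \<noteq> 0} \<union> {g. s g \<noteq> 0}"
  have T: "finite T" using assms by (auto simp: T_def group_ring_def)
  have "group_ring_l1_norm (r \<oplus>\<^bsub>group_ring G\<^esub> s) = (\<Sum>g\<in>T. nat \<bar>r g + s g\<bar>)"
    by (subst group_ring_l1_norm_eq[OF T]) (auto simp: T_def)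
  also have "\<dots> \<le> (\<Sum>g\<in>T. nat \<bar>r g\<bar> + nat \<bar>s g\<bar>)"
    by (rule sum_mono) auto
  also have "\<dots> = group_ring_l1_norm r + group_ring_l1_norm s"
    using T by (simp add: group_ring_l1_norm_eq[of T] T_def sum.distrib)
  finally show ?thesis .
qed

lemma group_ring_neg:
  assumes "group G" "r \<in> carrier (group_ring G)"
  shows "(\<ominus>\<^bsub>group_ring G\<^esub> r) g = - r g"
proof -
  interpret ring "group_ring G" using assms(1) by (rule ring_group_ring)
  have "(\<ominus>\<^bsub>group_ring G\<^esub> r \<oplus>\<^bsub>group_ring G\<^esub> r) g = \<zero>\<^bsub>group_ring G\<^esub> g"
    using assms(2) by (simp only: l_neg)
  thus ?thesis by simp
qed

lemma group_ring_l1_norm_neg: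
  assumes "group G" "r \<in> carrier (group_ring G)"
  shows "group_ring_l1_norm (\<ominus>\<^bsub>group_ring G\<^esub> r) = group_ring_l1_norm r"
  by (simp add: group_ring_l1_norm_def group_ring_neg[OF assms])

lemma (in group) group_ring_l1_norm_translate:
  assumes "g \<in> carrier G" "r \<in> carrier (group_ring G)"
  shows "group_ring_l1_norm (group_ring_of g \<otimes>\<^bsub>group_ring G\<^esub> r) = group_ring_l1_norm r"
proof -
  let ?s = "group_ring_of g \<otimes>\<^bsub>group_ring G\<^esub> r"
  have s: "?s \<in> carrier (group_ring G)"
    by (rule group_ring_mult_closed) (use assms is_group in auto)
  have sub: "x \<in> carrier G" if "r x \<noteq> 0 \<or> ?s x \<noteq> 0" for x
    using that assms(2) s by (auto simp: group_ring_carrier_iff)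
  have eq: "?s (g \<otimes> x) = r x" if "x \<in> carrier G" for x
    using that assms by (simp add: group_ring_of_mult_left m_assoc[symmetric])
  show ?thesis unfolding group_ring_l1_norm_def
  proof (rule sum.reindex_bij_witness[of _ "\<lambda>x. g \<otimes> x" "\<lambda>x. inv g \<otimes> x"])
    fix x assume x: "x \<in> {x. ?s x \<noteq> 0}"
    hence xc: "x \<in> carrier G" using sub by auto
    show "g \<otimes> (inv g \<otimes> x) = x" using xc assms by (simp add: m_assoc[symmetric])
    show "inv g \<otimes> x \<in> {x. r x \<noteq> 0}" "nat \<bar>r (inv g \<otimes> x)\<bar> = nat \<bar>?s x\<bar>"
      using x xc assms by (auto simp: group_ring_of_mult_left)
  next
    fix x assume x: "x \<in> {x. r x \<noteq> 0}"
    hence xc: "x \<in> carrier G" using sub by auto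
    show "inv g \<otimes> (g \<otimes> x) = x" using xc assms by (simp add: m_assoc[symmetric])
    show "g \<otimes> x \<in> {x. ?s x \<noteq> 0}" using x xc eq by auto
  qed
qed

lemma group_ring_slice:
  assumes "finite S" "S \<subseteq> carrier G \<times> I" "\<And>j. j \<notin> S \<Longrightarrow> c j = (0::int)"
  shows "(\<lambda>g. c (g, i)) \<in> carrier (group_ring G)"
proof -
  have "g \<in> fst ` S" if "c (g, i) \<noteq> 0" for g
    using that assms(3)[of "(g, i)"] by (force intro: image_eqI[of _ _ "(g, i)"])
  hence "{g. c (g, i) \<noteq> 0} \<subseteq> fst ` S" by blast
  moreover have "fst ` S \<subseteq> carrier G" using assms(2) by auto
  ultimately show ?thesis
    using finite_subset[OF _ finite_imageI[OF assms(1), of fst]] by (simp add: group_ring_carrier_iff)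
qed

lemma finite_basis_coords_unique:
  assumes "finite_basis R F I \<alpha>" "x \<in> carrier F"
    and "c \<in> I \<rightarrow>\<^sub>E carrier R" "x = (\<Oplus>\<^bsub>F\<^esub>i\<in>I. c i \<odot>\<^bsub>F\<^esub> \<alpha> i)"
    and "d \<in> I \<rightarrow>\<^sub>E carrier R" "x = (\<Oplus>\<^bsub>F\<^esub>i\<in>I. d i \<odot>\<^bsub>F\<^esub> \<alpha> i)"
  shows "c = d"
  using assms unfolding finite_basis_def by metis

context group_module
begin

lemma signed_orbits_subset: "A \<subseteq> carrier N \<Longrightarrow> signed_orbits G N A \<subseteq> carrier N"
  by (auto simp: signed_orbits_def)

text \<open>Collecting, for each basis element, the integers attached to its translates into one group
  ring coefficient turns an integral combination of the \<open>g \<cdot> \<alpha> i\<close> into a combination of the \<open>\<alpha> i\<close>.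
  The induction removes one translate at a time from the support.\<close>

lemma integral_combination_eq:
  assumes I: "finite I" "\<alpha> \<in> I \<rightarrow> carrier N"
    and S: "finite S" "S \<subseteq> carrier G \<times> I"
    and c: "\<And>j. j \<notin> S \<Longrightarrow> c j = 0"
  shows "(\<Oplus>\<^bsub>N\<^esub>j\<in>S. [c j] \<cdot>\<^bsub>N\<^esub> (case j of (g, i) \<Rightarrow> act g (\<alpha> i))) =
    (\<Oplus>\<^bsub>N\<^esub>i\<in>I. (\<lambda>g. c (g, i)) \<odot>\<^bsub>N\<^esub> \<alpha> i)"
  using S c
proof (induction S arbitrary: c rule: finite_induct)
  case empty
  have "(\<lambda>g. c (g, i)) = \<zero>\<^bsub>group_ring G\<^esub>" for i
    by (rule ext) (simp add: empty)
  hence "(\<Oplus>\<^bsub>N\<^esub>i\<in>I. (\<lambda>g. c (g, i)) \<odot>\<^bsub>N\<^esub> \<alpha> i) = (\<Oplus>\<^bsub>N\<^esub>i\<in>I. \<zero>\<^bsub>N\<^esub>)"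
    using I(2) by (intro M.finsum_cong') (auto simp: Pi_def)
  thus ?case by simp
next
  case (insert j S)
  obtain g i where j: "j = (g, i)" "g \<in> carrier G" "i \<in> I" using insert.prems(1) by auto
  define d where "d = c(j := 0)"
  define n where "n = c j"
  let ?b = "\<lambda>j. case j of (g, i) \<Rightarrow> act g (\<alpha> i)"
  let ?e = "\<lambda>k h. if k = i \<and> h = g then n else 0"
  have b: "?b k \<in> carrier N" if "k \<in> insert j S" for k
  proof -
    obtain h m where k: "k = (h, m)" by (cases k)
    have "h \<in> carrier G" "m \<in> I" using subsetD[OF insert.prems(1) that] by (simp_all add: k)
    thus ?thesis using funcset_mem[OF I(2)] by (simp add: k)
  qed
  have dR: "(\<lambda>h. d (h, k)) \<in> carrier (group_ring G)" for k
  proof (rule group_ring_slice[OF insert.hyps(1)])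
    show "S \<subseteq> carrier G \<times> I" using insert.prems(1) by simp
    show "d j' = 0" if "j' \<notin> S" for j' using that insert.prems(2)[of j'] by (simp add: d_def)
  qed
  have eR: "?e k \<in> carrier (group_ring G)" for k
    using j by (auto simp: group_ring_carrier_iff)
  have split: "(\<lambda>h. c (h, k)) = ?e k \<oplus>\<^bsub>group_ring G\<^esub> (\<lambda>h. d (h, k))" for k
    by (rule ext) (auto simp: d_def n_def j)
  have "(\<Oplus>\<^bsub>N\<^esub>k\<in>insert j S. [c k] \<cdot>\<^bsub>N\<^esub> ?b k) = [n] \<cdot>\<^bsub>N\<^esub> ?b j \<oplus>\<^bsub>N\<^esub> (\<Oplus>\<^bsub>N\<^esub>k\<in>S. [c k] \<cdot>\<^bsub>N\<^esub> ?b k)"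
    unfolding n_def using insert.hyps b by (intro M.finsum_insert) auto
  also have "(\<Oplus>\<^bsub>N\<^esub>k\<in>S. [c k] \<cdot>\<^bsub>N\<^esub> ?b k) = (\<Oplus>\<^bsub>N\<^esub>k\<in>S. [d k] \<cdot>\<^bsub>N\<^esub> ?b k)"
    by (rule M.finsum_cong') (use b insert.hyps in \<open>auto simp: d_def\<close>)
  also have "\<dots> = (\<Oplus>\<^bsub>N\<^esub>k\<in>I. (\<lambda>h. d (h, k)) \<odot>\<^bsub>N\<^esub> \<alpha> k)"
    by (rule insert.IH) (use insert.prems in \<open>auto simp: d_def\<close>)
  also have "[n] \<cdot>\<^bsub>N\<^esub> ?b j = ?e i \<odot>\<^bsub>N\<^esub> \<alpha> i"
    using int_multiple_act[of g "\<alpha> i" n, OF j(2) funcset_mem[OF I(2) j(3)]] j(1) by simp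
  also have "\<dots> = (\<Oplus>\<^bsub>N\<^esub>k\<in>I. if i = k then ?e k \<odot>\<^bsub>N\<^esub> \<alpha> k else \<zero>\<^bsub>N\<^esub>)"
    by (rule M.finsum_singleton[symmetric]) (use I j eR in auto)
  also have "\<dots> = (\<Oplus>\<^bsub>N\<^esub>k\<in>I. ?e k \<odot>\<^bsub>N\<^esub> \<alpha> k)"
  proof (rule M.finsum_cong'[OF refl])
    fix k assume k: "k \<in> I"
    have "?e k = \<zero>\<^bsub>group_ring G\<^esub>" if "k \<noteq> i" using that by auto
    thus "(if i = k then ?e k \<odot>\<^bsub>N\<^esub> \<alpha> k else \<zero>\<^bsub>N\<^esub>) = ?e k \<odot>\<^bsub>N\<^esub> \<alpha> k"
      using k I(2) by (cases "k = i") (auto simp: Pi_def)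
  qed (use I(2) eR in auto)
  also have "\<dots> \<oplus>\<^bsub>N\<^esub> (\<Oplus>\<^bsub>N\<^esub>k\<in>I. (\<lambda>h. d (h, k)) \<odot>\<^bsub>N\<^esub> \<alpha> k) =
      (\<Oplus>\<^bsub>N\<^esub>k\<in>I. ?e k \<odot>\<^bsub>N\<^esub> \<alpha> k \<oplus>\<^bsub>N\<^esub> (\<lambda>h. d (h, k)) \<odot>\<^bsub>N\<^esub> \<alpha> k)"
    by (rule M.finsum_addf[symmetric]) (use I(2) eR dR in auto)
  also have "\<dots> = (\<Oplus>\<^bsub>N\<^esub>k\<in>I. (\<lambda>h. c (h, k)) \<odot>\<^bsub>N\<^esub> \<alpha> k)"
  proof (rule M.finsum_cong'[OF refl])
    fix k assume k: "k \<in> I"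
    hence a: "\<alpha> k \<in> carrier N" using I(2) by auto
    show "?e k \<odot>\<^bsub>N\<^esub> \<alpha> k \<oplus>\<^bsub>N\<^esub> (\<lambda>h. d (h, k)) \<odot>\<^bsub>N\<^esub> \<alpha> k = (\<lambda>h. c (h, k)) \<odot>\<^bsub>N\<^esub> \<alpha> k"
      unfolding split by (rule smult_l_distr[symmetric]) (use eR dR a in auto)
  next
    show "(\<lambda>k. (\<lambda>h. c (h, k)) \<odot>\<^bsub>N\<^esub> \<alpha> k) \<in> I \<rightarrow> carrier N"
      unfolding split using I(2) eR dR by auto
  qed
  finally show ?case .
qed

context
  fixes I :: "'i set" and \<alpha>
  assumes basis: "finite_basis (group_ring G) N I \<alpha>"
begin

lemma basis_facts: "finite I" "\<alpha> \<in> I \<rightarrow> carrier N"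
  using basis by (auto simp: finite_basis_def)

text \<open>Being a basis over the group ring thus amounts to the \<open>g \<cdot> \<alpha> i\<close> being a basis over the
  integers, with the same coefficients read in two ways.\<close>

lemma int_coords_basis:
  assumes c: "c \<in> I \<rightarrow>\<^sub>E carrier (group_ring G)"
    and x: "x = (\<Oplus>\<^bsub>N\<^esub>i\<in>I. c i \<odot>\<^bsub>N\<^esub> \<alpha> i)"
  defines "C \<equiv> \<lambda>(g, i). if i \<in> I then c i g else 0"
  shows "finite {j. C j \<noteq> 0}" "{j. C j \<noteq> 0} \<subseteq> carrier G \<times> I"
    and "x = (\<Oplus>\<^bsub>N\<^esub>j\<in>{j. C j \<noteq> 0}. [C j] \<cdot>\<^bsub>N\<^esub> (\<lambda>(g, i). act g (\<alpha> i)) j)"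
    and "int_coords N (carrier G \<times> I) (\<lambda>(g, i). act g (\<alpha> i)) x = C"
proof -
  have cR: "finite {g. c i g \<noteq> 0}" "{g. c i g \<noteq> 0} \<subseteq> carrier G" if "i \<in> I" for i
    using c that by (auto simp: group_ring_carrier_iff dest!: PiE_mem)
  have "{j. C j \<noteq> 0} \<subseteq> (\<Union>i\<in>I. {g. c i g \<noteq> 0}) \<times> I" by (auto simp: C_def split: if_splits)
  moreover have "finite ((\<Union>i\<in>I. {g. c i g \<noteq> 0}) \<times> I)" using cR basis_facts by auto
  ultimately show fin: "finite {j. C j \<noteq> 0}" by (rule finite_subset)
  show sub: "{j. C j \<noteq> 0} \<subseteq> carrier G \<times> I" using cR(2) by (fastforce simp: C_def split: if_splits)
  have xc: "x \<in> carrier N" unfolding x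
    by (rule M.finsum_closed) (use c basis_facts in \<open>auto dest!: PiE_mem\<close>)
  have "(\<Oplus>\<^bsub>N\<^esub>j\<in>{j. C j \<noteq> 0}. [C j] \<cdot>\<^bsub>N\<^esub> (\<lambda>(g, i). act g (\<alpha> i)) j) =
      (\<Oplus>\<^bsub>N\<^esub>i\<in>I. (\<lambda>g. C (g, i)) \<odot>\<^bsub>N\<^esub> \<alpha> i)"
    by (rule integral_combination_eq[OF basis_facts fin sub]) simp
  also have "\<dots> = x" unfolding x
    by (rule M.finsum_cong') (use c basis_facts in \<open>auto simp: C_def dest!: PiE_mem\<close>)
  finally show eq: "x = (\<Oplus>\<^bsub>N\<^esub>j\<in>{j. C j \<noteq> 0}. [C j] \<cdot>\<^bsub>N\<^esub> (\<lambda>(g, i). act g (\<alpha> i)) j)" ..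
  show "int_coords N (carrier G \<times> I) (\<lambda>(g, i). act g (\<alpha> i)) x = C"
    unfolding int_coords_def
  proof (rule the_equality)
    fix d :: "'g \<times> 'i \<Rightarrow> int" assume d: "finite {j. d j \<noteq> 0} \<and> {j. d j \<noteq> 0} \<subseteq> carrier G \<times> I \<and>
      x = (\<Oplus>\<^bsub>N\<^esub>j\<in>{j. d j \<noteq> 0}. [d j] \<cdot>\<^bsub>N\<^esub> (\<lambda>(g, i). act g (\<alpha> i)) j)"
    note fin_d = conjunct1[OF d] and sub_d = conjunct1[OF conjunct2[OF d]]
      and eq_d = conjunct2[OF conjunct2[OF d]]
    define d' where "d' = (\<lambda>i\<in>I. \<lambda>g. d (g, i))"
    have dR: "(\<lambda>g. d (g, i)) \<in> carrier (group_ring G)" for i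
      by (rule group_ring_slice[OF fin_d sub_d]) simp
    hence d': "d' \<in> I \<rightarrow>\<^sub>E carrier (group_ring G)" by (auto simp: d'_def)
    have "x = (\<Oplus>\<^bsub>N\<^esub>i\<in>I. (\<lambda>g. d (g, i)) \<odot>\<^bsub>N\<^esub> \<alpha> i)"
      unfolding eq_d by (rule integral_combination_eq[OF basis_facts fin_d sub_d]) simp
    also have "\<dots> = (\<Oplus>\<^bsub>N\<^esub>i\<in>I. d' i \<odot>\<^bsub>N\<^esub> \<alpha> i)"
      by (rule M.finsum_cong') (use dR basis_facts in \<open>auto simp: d'_def\<close>)
    finally have x_d': "x = (\<Oplus>\<^bsub>N\<^esub>i\<in>I. d' i \<odot>\<^bsub>N\<^esub> \<alpha> i)" .
    have "d' = c"
      by (rule finite_basis_coords_unique[OF basis xc d' x_d' c x])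
    show "d = C"
    proof
      fix j show "d j = C j"
      proof (cases "snd j \<in> I")
        case True
        have "c (snd j) (fst j) = d' (snd j) (fst j)" using \<open>d' = c\<close> by simp
        thus ?thesis using True unfolding C_def d'_def by (cases j) simp
      next
        case False
        hence "j \<notin> {j. d j \<noteq> 0}" using sub_d by auto
        thus ?thesis using False unfolding C_def by (cases j) simp
      qed
    qed
  qed (rule conjI[OF fin conjI[OF sub eq]])
qed

lemma coords_exist:
  assumes "x \<in> carrier N"
  obtains c where "c \<in> I \<rightarrow>\<^sub>E carrier (group_ring G)" "x = (\<Oplus>\<^bsub>N\<^esub>i\<in>I. c i \<odot>\<^bsub>N\<^esub> \<alpha> i)"
  using assms basis unfolding finite_basis_def by blast

lemma free_norm_coords:
  assumes c: "\<And>i. i \<in> I \<Longrightarrow> c i \<in> carrier (group_ring G)"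
  shows "free_norm G N I \<alpha> (\<Oplus>\<^bsub>N\<^esub>i\<in>I. c i \<odot>\<^bsub>N\<^esub> \<alpha> i) = (\<Sum>i\<in>I. group_ring_l1_norm (c i))"
proof -
  define e where "e = restrict c I"
  have e: "e \<in> I \<rightarrow>\<^sub>E carrier (group_ring G)" using c by (auto simp: e_def)
  define C where "C = (\<lambda>(g, i). if i \<in> I then e i g else 0)"
  let ?x = "\<Oplus>\<^bsub>N\<^esub>i\<in>I. c i \<odot>\<^bsub>N\<^esub> \<alpha> i"
  have x: "?x = (\<Oplus>\<^bsub>N\<^esub>i\<in>I. e i \<odot>\<^bsub>N\<^esub> \<alpha> i)"
    by (rule M.finsum_cong') (use c basis_facts in \<open>auto simp: e_def\<close>)
  have "free_norm G N I \<alpha> ?x = (\<Sum>j | C j \<noteq> 0. nat \<bar>C j\<bar>)"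
    unfolding free_norm_def l1_norm_def int_coords_basis(4)[OF e x] C_def ..
  also have "\<dots> = (\<Sum>(i, g)\<in>Sigma I (\<lambda>i. {g. c i g \<noteq> 0}). nat \<bar>c i g\<bar>)"
    by (rule sum.reindex_bij_witness[of _ prod.swap prod.swap])
       (auto simp: C_def e_def split: if_splits)
  also have "\<dots> = (\<Sum>i\<in>I. group_ring_l1_norm (c i))"
    unfolding group_ring_l1_norm_def
    by (rule sum.Sigma[symmetric]) (use c basis_facts in \<open>auto simp: group_ring_carrier_iff\<close>)
  finally show ?thesis .
qed

text \<open>All three inequalities are read off coefficientwise; negation and translation are both
  multiplication by a scalar that preserves the norm of every group ring element.\<close>

lemma free_norm_invariant: "invariant_norm_on G N (carrier N) (free_norm G N I \<alpha>)"
  unfolding invariant_norm_on_def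
proof (intro conjI ballI)
  let ?R = "group_ring G" and ?n = "free_norm G N I \<alpha>"
  have clo: "c i \<in> carrier ?R" if "c \<in> I \<rightarrow>\<^sub>E carrier ?R" "i \<in> I" for c i
    using that by auto
  have \<alpha>: "\<alpha> i \<in> carrier N" if "i \<in> I" for i using that basis_facts by auto
  have "\<zero>\<^bsub>N\<^esub> = (\<Oplus>\<^bsub>N\<^esub>i\<in>I. \<zero>\<^bsub>?R\<^esub> \<odot>\<^bsub>N\<^esub> \<alpha> i)"
    using M.finsum_cong'[of I I "\<lambda>i. \<zero>\<^bsub>N\<^esub>" "\<lambda>i. \<zero>\<^bsub>?R\<^esub> \<odot>\<^bsub>N\<^esub> \<alpha> i"] \<alpha> by simp
  moreover have "group_ring_l1_norm \<zero>\<^bsub>?R\<^esub> = 0" by (simp add: group_ring_l1_norm_def)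
  ultimately show "?n \<zero>\<^bsub>N\<^esub> = 0" using free_norm_coords[of "\<lambda>_. \<zero>\<^bsub>?R\<^esub>"] by simp
  {
    fix x y assume x: "x \<in> carrier N" and y: "y \<in> carrier N"
    obtain c where c: "c \<in> I \<rightarrow>\<^sub>E carrier ?R" "x = (\<Oplus>\<^bsub>N\<^esub>i\<in>I. c i \<odot>\<^bsub>N\<^esub> \<alpha> i)"
      using coords_exist[OF x] .
    obtain d where d: "d \<in> I \<rightarrow>\<^sub>E carrier ?R" "y = (\<Oplus>\<^bsub>N\<^esub>i\<in>I. d i \<odot>\<^bsub>N\<^esub> \<alpha> i)"
      using coords_exist[OF y] .
    note clo = clo[OF c(1)] clo[OF d(1)]
    have "x \<oplus>\<^bsub>N\<^esub> y = (\<Oplus>\<^bsub>N\<^esub>i\<in>I. c i \<odot>\<^bsub>N\<^esub> \<alpha> i \<oplus>\<^bsub>N\<^esub> d i \<odot>\<^bsub>N\<^esub> \<alpha> i)"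
      unfolding c(2) d(2) by (rule M.finsum_addf[symmetric]) (use clo \<alpha> in auto)
    also have "\<dots> = (\<Oplus>\<^bsub>N\<^esub>i\<in>I. (c i \<oplus>\<^bsub>?R\<^esub> d i) \<odot>\<^bsub>N\<^esub> \<alpha> i)"
      by (rule M.finsum_cong') (use clo \<alpha> in \<open>auto simp: smult_l_distr\<close>)
    finally have "?n (x \<oplus>\<^bsub>N\<^esub> y) = (\<Sum>i\<in>I. group_ring_l1_norm (c i \<oplus>\<^bsub>?R\<^esub> d i))"
      using free_norm_coords[of "\<lambda>i. c i \<oplus>\<^bsub>?R\<^esub> d i"] clo by simp
    also have "\<dots> \<le> (\<Sum>i\<in>I. group_ring_l1_norm (c i) + group_ring_l1_norm (d i))"
      by (intro sum_mono group_ring_l1_norm_add) (use clo in auto)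
    also have "\<dots> = ?n x + ?n y"
      unfolding c(2) d(2) using clo by (simp add: free_norm_coords sum.distrib)
    finally show "?n (x \<oplus>\<^bsub>N\<^esub> y) \<le> ?n x + ?n y" .
  }
  have scalar: "?n (a \<odot>\<^bsub>N\<^esub> x) \<le> ?n x"
    if a: "a \<in> carrier ?R" "\<And>r. r \<in> carrier ?R \<Longrightarrow> group_ring_l1_norm (a \<otimes>\<^bsub>?R\<^esub> r) = group_ring_l1_norm r"
      and x: "x \<in> carrier N" for a x
  proof -
    obtain c where c: "c \<in> I \<rightarrow>\<^sub>E carrier ?R" "x = (\<Oplus>\<^bsub>N\<^esub>i\<in>I. c i \<odot>\<^bsub>N\<^esub> \<alpha> i)"
      using coords_exist[OF x] .
    note clo = clo[OF c(1)]
    have "a \<odot>\<^bsub>N\<^esub> x = (\<Oplus>\<^bsub>N\<^esub>i\<in>I. a \<odot>\<^bsub>N\<^esub> (c i \<odot>\<^bsub>N\<^esub> \<alpha> i))"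
      unfolding c(2) by (rule finsum_smult) (use clo \<alpha> a basis_facts in auto)
    also have "\<dots> = (\<Oplus>\<^bsub>N\<^esub>i\<in>I. (a \<otimes>\<^bsub>?R\<^esub> c i) \<odot>\<^bsub>N\<^esub> \<alpha> i)"
      by (rule M.finsum_cong') (use clo \<alpha> a in \<open>auto simp: smult_assoc1\<close>)
    finally have "?n (a \<odot>\<^bsub>N\<^esub> x) = (\<Sum>i\<in>I. group_ring_l1_norm (a \<otimes>\<^bsub>?R\<^esub> c i))"
      using free_norm_coords[of "\<lambda>i. a \<otimes>\<^bsub>?R\<^esub> c i"] clo a by simp
    also have "\<dots> = ?n x"
      unfolding c(2) using clo a by (simp add: free_norm_coords)
    finally show ?thesis by simp
  qed
  fix x assume x: "x \<in> carrier N"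
  show "?n (group_ring_of g \<odot>\<^bsub>N\<^esub> x) \<le> ?n x" if "g \<in> carrier G" for g
    by (rule scalar) (use that x group_ring_l1_norm_translate in auto)
  have "?n ((\<ominus>\<^bsub>?R\<^esub> \<one>\<^bsub>?R\<^esub>) \<odot>\<^bsub>N\<^esub> x) \<le> ?n x"
    by (rule scalar) (use x in \<open>auto simp: R.l_minus group_ring_l1_norm_neg is_group\<close>)
  thus "?n (\<ominus>\<^bsub>N\<^esub> x) \<le> ?n x" using x by (simp add: smult_neg_left)
qed

text \<open>An integer coefficient \<open>c\<close> of a translate contributes \<open>\<bar>c\<bar>\<close> equal letters.\<close>

lemma free_norm_list:
  assumes "x \<in> carrier N"
  obtains L where "set L \<subseteq> signed_orbits G N (\<alpha> ` I)" "length L = free_norm G N I \<alpha> x" "list_sum N L = x"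
proof -
  obtain c where c: "c \<in> I \<rightarrow>\<^sub>E carrier (group_ring G)" "x = (\<Oplus>\<^bsub>N\<^esub>i\<in>I. c i \<odot>\<^bsub>N\<^esub> \<alpha> i)"
    using coords_exist[OF assms] .
  define C where "C = (\<lambda>(g, i). if i \<in> I then c i g else 0)"
  let ?b = "\<lambda>(g, i). act g (\<alpha> i)"
  note co = int_coords_basis[OF c, folded C_def]
  have sub: "signed_orbits G N (\<alpha> ` I) \<subseteq> carrier N"
    by (rule signed_orbits_subset) (use basis_facts in auto)
  have "\<exists>L. set L \<subseteq> signed_orbits G N (\<alpha> ` I) \<and> length L = (\<Sum>j\<in>S. nat \<bar>C j\<bar>) \<and>
      list_sum N L = (\<Oplus>\<^bsub>N\<^esub>j\<in>S. [C j] \<cdot>\<^bsub>N\<^esub> ?b j)" if "finite S" "S \<subseteq> carrier G \<times> I" for S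
    using that
  proof (induction S rule: finite_induct)
    case empty
    show ?case by (intro exI[of _ "[]"]) simp
  next
    case (insert j S)
    then obtain L where L: "set L \<subseteq> signed_orbits G N (\<alpha> ` I)" "length L = (\<Sum>j\<in>S. nat \<bar>C j\<bar>)"
      "list_sum N L = (\<Oplus>\<^bsub>N\<^esub>j\<in>S. [C j] \<cdot>\<^bsub>N\<^esub> ?b j)" by auto
    have b: "?b k \<in> carrier N" if "k \<in> insert j S" for k
    proof -
      obtain h m where k: "k = (h, m)" by (cases k)
      have "h \<in> carrier G" "m \<in> I" using subsetD[OF insert.prems that] by (simp_all add: k)
      thus ?thesis using funcset_mem[OF basis_facts(2)] by (simp add: k)
    qed
    obtain L' where L': "set L' \<subseteq> {?b j, \<ominus>\<^bsub>N\<^esub> ?b j}" "length L' = nat \<bar>C j\<bar>"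
      "list_sum N L' = [C j] \<cdot>\<^bsub>N\<^esub> ?b j"
      using M.int_multiple_list[OF b[of j], of "C j"] by auto
    have L'': "set L' \<subseteq> signed_orbits G N (\<alpha> ` I)"
      using L'(1) insert.prems by (fastforce simp: signed_orbits_def)
    show ?case
    proof (intro exI conjI)
      show "set (L' @ L) \<subseteq> signed_orbits G N (\<alpha> ` I)" using L(1) L'' by simp
      show "length (L' @ L) = (\<Sum>j\<in>insert j S. nat \<bar>C j\<bar>)"
        using insert.hyps L(2) L'(2) by simp
      have "list_sum N (L' @ L) = [C j] \<cdot>\<^bsub>N\<^esub> ?b j \<oplus>\<^bsub>N\<^esub> (\<Oplus>\<^bsub>N\<^esub>j\<in>S. [C j] \<cdot>\<^bsub>N\<^esub> ?b j)"
        using M.list_sum_append[of L' L] L L' L'' sub by auto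
      also have "\<dots> = (\<Oplus>\<^bsub>N\<^esub>j\<in>insert j S. [C j] \<cdot>\<^bsub>N\<^esub> ?b j)"
        using insert.hyps b by (intro M.finsum_insert[symmetric]) auto
      finally show "list_sum N (L' @ L) = (\<Oplus>\<^bsub>N\<^esub>j\<in>insert j S. [C j] \<cdot>\<^bsub>N\<^esub> ?b j)" .
    qed
  qed
  from this[OF co(1,2)] show ?thesis
    using that co(3) unfolding free_norm_def l1_norm_def co(4) by metis
qed

end

end

section \<open>Filling norms\<close>

lemma invariant_norm_onD:
  assumes "invariant_norm_on G N K \<nu>"
  shows "\<nu> \<zero>\<^bsub>N\<^esub> = 0"
    and "x \<in> K \<Longrightarrow> y \<in> K \<Longrightarrow> \<nu> (x \<oplus>\<^bsub>N\<^esub> y) \<le> \<nu> x + \<nu> y"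
    and "x \<in> K \<Longrightarrow> \<nu> (\<ominus>\<^bsub>N\<^esub> x) \<le> \<nu> x"
    and "g \<in> carrier G \<Longrightarrow> x \<in> K \<Longrightarrow> \<nu> (group_ring_of g \<odot>\<^bsub>N\<^esub> x) \<le> \<nu> x"
  using assms by (simp_all add: invariant_norm_on_def)

lemma group_module_iff: "group_module G N \<longleftrightarrow> group G \<and> left_module (group_ring G) N"
  by (simp add: group_module_def)

lemma signed_orbits_image:
  assumes "group_module G M" "group_module G N" "f \<in> linear_maps (group_ring G) M N" "A \<subseteq> carrier M"
  shows "f ` signed_orbits G M A \<subseteq> signed_orbits G N (f ` A)"
proof -
  interpret M: group_module G M by fact
  interpret N: group_module G N by fact
  have "f (M.act g a) = N.act g (f a)" "f (\<ominus>\<^bsub>M\<^esub> M.act g a) = \<ominus>\<^bsub>N\<^esub> N.act g (f a)"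
    if "g \<in> carrier G" "a \<in> A" for g a
    using that assms(4) linear_maps_neg[OF M.left_module_axioms N.left_module_axioms assms(3), of "M.act g a"]
    by (auto simp: linear_maps_smult[OF assms(3)] subset_iff)
  thus ?thesis unfolding signed_orbits_def by fastforce
qed

lemma (in group_module) signed_orbits_act:
  assumes "A \<subseteq> carrier N" "g \<in> carrier G" "b \<in> signed_orbits G N A"
  shows "act g b \<in> signed_orbits G N A"
proof -
  obtain h a where h: "h \<in> carrier G" "a \<in> A" "b = act h a \<or> b = \<ominus>\<^bsub>N\<^esub> act h a"
    using assms(3) by (auto simp: signed_orbits_def)
  have a: "a \<in> carrier N" using h assms(1) by auto
  have "act g b = act (g \<otimes> h) a \<or> act g b = \<ominus>\<^bsub>N\<^esub> act (g \<otimes> h) a"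
    using h(1,3) a assms(2) by (auto simp: smult_neg act_act)
  moreover have "g \<otimes> h \<in> carrier G" using assms(2) h(1) by simp
  ultimately show ?thesis using h(2) unfolding signed_orbits_def by blast
qed

lemma induced_norm_attained:
  assumes "m \<in> f ` carrier P"
  obtains x where "x \<in> carrier P" "f x = m" "\<nu> x = induced_norm P \<nu> f m"
proof -
  have "\<exists>n. \<exists>x\<in>carrier P. f x = m \<and> \<nu> x = n" using assms by blast
  from LeastI_ex[OF this] show ?thesis using that unfolding induced_norm_def by blast
qed

lemma induced_norm_le:
  assumes "x \<in> carrier P"
  shows "induced_norm P \<nu> f (f x) \<le> \<nu> x"
  unfolding induced_norm_def by (rule Least_le) (use assms in blast)

text \<open>Norm-minimising preimages of \<open>x\<close> and \<open>y\<close> yield preimages of \<open>x \<oplus> y\<close>, of \<open>\<ominus> x\<close> and of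
  translates of \<open>x\<close>, whose norms bound the induced norm from above.\<close>

lemma induced_norm_invariant:
  assumes "group_module G P" "group_module G N" "f \<in> linear_maps (group_ring G) P N"
    and \<nu>: "invariant_norm_on G P (carrier P) \<nu>"
  shows "invariant_norm_on G N (f ` carrier P) (induced_norm P \<nu> f)"
proof -
  interpret P: group_module G P by fact
  interpret N: group_module G N by fact
  note f = assms(3)
  let ?n = "induced_norm P \<nu> f"
  have zero: "f \<zero>\<^bsub>P\<^esub> = \<zero>\<^bsub>N\<^esub>"
    by (rule linear_maps_zero[OF P.left_module_axioms N.left_module_axioms f])
  show ?thesis
    unfolding invariant_norm_on_def
  proof (intro conjI ballI)
    show "?n \<zero>\<^bsub>N\<^esub> = 0"
      using induced_norm_le[of "\<zero>\<^bsub>P\<^esub>" P \<nu> f] invariant_norm_onD(1)[OF \<nu>] zero by simp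
  next
    fix x y assume x: "x \<in> f ` carrier P" and y: "y \<in> f ` carrier P"
    obtain x' where x': "x' \<in> carrier P" "f x' = x" "\<nu> x' = ?n x"
      by (rule induced_norm_attained[OF x])
    obtain y' where y': "y' \<in> carrier P" "f y' = y" "\<nu> y' = ?n y"
      by (rule induced_norm_attained[OF y])
    have "?n (x \<oplus>\<^bsub>N\<^esub> y) \<le> \<nu> (x' \<oplus>\<^bsub>P\<^esub> y')"
      using induced_norm_le[OF P.M.a_closed[OF x'(1) y'(1)], of \<nu> f]
      by (simp add: linear_maps_add[OF f x'(1) y'(1)] x'(2) y'(2))
    also have "\<dots> \<le> ?n x + ?n y"
      using invariant_norm_onD(2)[OF \<nu> x'(1) y'(1)] by (simp add: x'(3) y'(3))
    finally show "?n (x \<oplus>\<^bsub>N\<^esub> y) \<le> ?n x + ?n y" .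
  next
    fix x assume x: "x \<in> f ` carrier P"
    obtain x' where x': "x' \<in> carrier P" "f x' = x" "\<nu> x' = ?n x"
      by (rule induced_norm_attained[OF x])
    have "?n (\<ominus>\<^bsub>N\<^esub> x) \<le> \<nu> (\<ominus>\<^bsub>P\<^esub> x')"
      using induced_norm_le[OF P.M.a_inv_closed[OF x'(1)], of \<nu> f]
      by (simp add: linear_maps_neg[OF P.left_module_axioms N.left_module_axioms f x'(1)] x'(2))
    also have "\<dots> \<le> ?n x"
      using invariant_norm_onD(3)[OF \<nu> x'(1)] by (simp add: x'(3))
    finally show "?n (\<ominus>\<^bsub>N\<^esub> x) \<le> ?n x" .
  next
    fix g x assume g: "g \<in> carrier G" and x: "x \<in> f ` carrier P"
    obtain x' where x': "x' \<in> carrier P" "f x' = x" "\<nu> x' = ?n x"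
      by (rule induced_norm_attained[OF x])
    have "?n (N.act g x) \<le> \<nu> (P.act g x')"
      using induced_norm_le[OF P.act_closed[OF g x'(1)], of \<nu> f]
      by (simp add: linear_maps_smult[OF f group_ring_of_closed[OF g] x'(1)] x'(2))
    also have "\<dots> \<le> ?n x"
      using invariant_norm_onD(4)[OF \<nu> g x'(1)] by (simp add: x'(3))
    finally show "?n (N.act g x) \<le> ?n x" .
  qed
qed

text \<open>What the rest of the argument uses about filling norms: they are invariant, and they are
  realised by words in the signed translates of finitely many elements, namely the images of the
  basis of the free module.\<close>

lemma filling_norm_properties:
  fixes N :: "('g \<Rightarrow> int, 'n, 'x) module_scheme"
  assumes N: "group_module G N" and \<nu>: "filling_norm TYPE('f) TYPE('i) G N \<nu>"
  shows "invariant_norm_on G N (carrier N) \<nu>"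
    and "\<exists>A. finite A \<and> A \<subseteq> carrier N \<and> (\<forall>x\<in>carrier N. \<exists>L.
      set L \<subseteq> signed_orbits G N A \<and> length L = \<nu> x \<and> list_sum N L = x)"
proof -
  interpret N: group_module G N by fact
  let ?R = "group_ring G"
  obtain F :: "('g \<Rightarrow> int, 'f) module" and I :: "'i set" and \<alpha> \<eta>
    where F: "left_module ?R F" "finite_basis ?R F I \<alpha>"
      and \<eta>: "\<eta> \<in> linear_maps ?R F N" "\<eta> ` carrier F = carrier N"
      and eq: "\<forall>m\<in>carrier N. \<nu> m = induced_norm F (free_norm G F I \<alpha>) \<eta> m"
    using \<nu> unfolding filling_norm_def by blast
  have gF: "group_module G F" using F N.is_group by (simp add: group_module_iff)
  interpret F: group_module G F by fact
  have ind: "invariant_norm_on G N (carrier N) (induced_norm F (free_norm G F I \<alpha>) \<eta>)"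
    using induced_norm_invariant[OF gF N \<eta>(1) F.free_norm_invariant[OF F(2)]] unfolding \<eta>(2) .
  note eq' = bspec[OF eq]
  show "invariant_norm_on G N (carrier N) \<nu>"
    unfolding invariant_norm_on_def
    by (intro conjI ballI) (simp_all add: eq' invariant_norm_onD[OF ind])
  note basis = F.basis_facts[OF F(2)]
  show "\<exists>A. finite A \<and> A \<subseteq> carrier N \<and> (\<forall>x\<in>carrier N. \<exists>L.
      set L \<subseteq> signed_orbits G N A \<and> length L = \<nu> x \<and> list_sum N L = x)"
  proof (intro exI[of _ "\<eta> ` \<alpha> ` I"] conjI ballI)
    show "finite (\<eta> ` \<alpha> ` I)" using basis by simp
    show "\<eta> ` \<alpha> ` I \<subseteq> carrier N" using basis linear_maps_closed[OF \<eta>(1)] by auto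
    fix x assume x: "x \<in> carrier N"
    hence "x \<in> \<eta> ` carrier F" by (simp only: \<eta>(2))
    then obtain y where y: "y \<in> carrier F" "\<eta> y = x"
      "free_norm G F I \<alpha> y = induced_norm F (free_norm G F I \<alpha>) \<eta> x"
      by (rule induced_norm_attained)
    obtain L where L: "set L \<subseteq> signed_orbits G F (\<alpha> ` I)" "length L = free_norm G F I \<alpha> y" "list_sum F L = y"
      using F.free_norm_list[OF F(2) y(1)] .
    have sub: "\<alpha> ` I \<subseteq> carrier F" using basis by auto
    have LF: "set L \<subseteq> carrier F" using L(1) F.signed_orbits_subset[OF sub] by blast
    have "set (map \<eta> L) \<subseteq> signed_orbits G N (\<eta> ` \<alpha> ` I)"
      using L(1) signed_orbits_image[OF gF N \<eta>(1) sub] by auto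
    moreover have "length (map \<eta> L) = \<nu> x" using L(2) y(3) eq'[OF x] by simp
    moreover have "list_sum N (map \<eta> L) = x"
      using linear_maps_list_sum[OF F(1) N.left_module_axioms \<eta>(1) LF] L(3) y(2) by simp
    ultimately show "\<exists>L. set L \<subseteq> signed_orbits G N (\<eta> ` \<alpha> ` I) \<and> length L = \<nu> x \<and> list_sum N L = x"
      by blast
  qed
qed

text \<open>Invariance makes \<open>\<mu>\<close> bounded on the letters, since there are only finitely many of them up to
  sign and translation.\<close>

lemma invariant_norm_list_le:
  assumes N: "group_module G N" and \<mu>: "invariant_norm_on G N (carrier N) \<mu>"
    and A: "finite A" "A \<subseteq> carrier N"
  shows "\<exists>C. \<forall>L. set L \<subseteq> signed_orbits G N A \<longrightarrow> \<mu> (list_sum N L) \<le> C * length L"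
proof -
  interpret N: group_module G N by fact
  define C where "C = (\<Sum>a\<in>A. \<mu> a)"
  have letter: "\<mu> b \<le> C" "b \<in> carrier N" if b: "b \<in> signed_orbits G N A" for b
  proof -
    obtain g a where g: "g \<in> carrier G" "a \<in> A" "b = N.act g a \<or> b = \<ominus>\<^bsub>N\<^esub> N.act g a"
      using b by (auto simp: signed_orbits_def)
    have a: "a \<in> carrier N" "N.act g a \<in> carrier N" using g A by auto
    have "\<mu> b \<le> \<mu> (N.act g a)" using g(3) invariant_norm_onD(3)[OF \<mu> a(2)] by auto
    also have "\<dots> \<le> \<mu> a" by (rule invariant_norm_onD(4)[OF \<mu> g(1) a(1)])
    also have "\<dots> \<le> C" unfolding C_def using A(1) g(2) by (simp add: member_le_sum)
    finally show "\<mu> b \<le> C" .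
    show "b \<in> carrier N" using g(3) a by auto
  qed
  have "\<mu> (list_sum N L) \<le> C * length L" if "set L \<subseteq> signed_orbits G N A" for L
    using that
  proof (induction L)
    case Nil
    show ?case by (simp add: invariant_norm_onD(1)[OF \<mu>])
  next
    case (Cons b L)
    have "\<mu> (list_sum N (b # L)) \<le> \<mu> b + \<mu> (list_sum N L)"
      using invariant_norm_onD(2)[OF \<mu>, of b "list_sum N L"] Cons.prems letter(2)
        N.M.list_sum_closed[of L] by (simp add: subset_iff)
    thus ?case using Cons letter(1)[of b] by simp
  qed
  thus ?thesis by (intro exI[of _ C] allI impI)
qed

text \<open>Filling norms are the largest invariant norms up to a constant factor, so linear maps are
  bounded with respect to them. In particular any two filling norms on a module are equivalent.\<close>

lemma linear_map_bounded:
  assumes N: "group_module G N" and N': "group_module G N'" and f: "f \<in> linear_maps (group_ring G) N N'"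
    and \<nu>: "filling_norm TYPE('f) TYPE('i) G N \<nu>"
    and \<mu>: "invariant_norm_on G N' (carrier N') \<mu>"
  obtains C where "\<And>x. x \<in> carrier N \<Longrightarrow> \<mu> (f x) \<le> C * \<nu> x"
proof -
  interpret N: group_module G N by fact
  interpret N': group_module G N' by fact
  obtain A where A: "finite A" "A \<subseteq> carrier N" "\<forall>x\<in>carrier N. \<exists>L.
      set L \<subseteq> signed_orbits G N A \<and> length L = \<nu> x \<and> list_sum N L = x"
    using filling_norm_properties(2)[OF N \<nu>] by (elim exE conjE) (rule that)
  have fA: "finite (f ` A)" using A(1) by simp
  have fA': "f ` A \<subseteq> carrier N'"
    by (rule image_subsetI) (rule linear_maps_closed[OF f subsetD[OF A(2)]])
  obtain C where C: "\<forall>L. set L \<subseteq> signed_orbits G N' (f ` A) \<longrightarrow> \<mu> (list_sum N' L) \<le> C * length L"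
    using invariant_norm_list_le[OF N' \<mu> fA fA'] ..
  show ?thesis
  proof (rule that)
    fix x assume "x \<in> carrier N"
    then obtain L where L: "set L \<subseteq> signed_orbits G N A" "length L = \<nu> x" "list_sum N L = x"
      using A(3) by blast
    have "set L \<subseteq> carrier N" using L(1) N.signed_orbits_subset[OF A(2)] by blast
    hence "f x = list_sum N' (map f L)"
      using linear_maps_list_sum[OF N.left_module_axioms N'.left_module_axioms f] L(3) by metis
    moreover have "set (map f L) \<subseteq> signed_orbits G N' (f ` A)"
      using L(1) signed_orbits_image[OF N N' f A(2)] by auto
    ultimately show "\<mu> (f x) \<le> C * \<nu> x" using C[rule_format, of "map f L"] L(2) by simp
  qed
qed

section \<open>Short cycles\<close>

lemma (in abelian_group) additive_list_sum:
  assumes add: "\<And>x y. x \<in> carrier G \<Longrightarrow> y \<in> carrier G \<Longrightarrow> F (x \<oplus> y) = F x + (F y :: int)"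
    and L: "set L \<subseteq> carrier G" "\<And>b. b \<in> set L \<Longrightarrow> F b = 0"
  shows "F (list_sum G L) = 0"
  using L
proof (induction L)
  case Nil
  show ?case using add[of \<zero> \<zero>] by simp
next
  case (Cons b L)
  thus ?case using add[of b "list_sum G L"] by simp
qed

text \<open>An abstract boundary map: \<open>F e x\<close> is the coefficient of the boundary of \<open>x\<close> at the cell \<open>e\<close>,
  and \<open>K\<close> is the set of cycles. All that is kept of the target module is the local finiteness of
  the incidence between letters and cells, as this is what bounds connected cycles.\<close>

locale locally_finite_boundary = group_module G N
  for G :: "('g, 'y) monoid_scheme" (structure) and N :: "('g \<Rightarrow> int, 'n, 'x) module_scheme" +
  fixes A :: "'n set" and F :: "'e \<Rightarrow> 'n \<Rightarrow> int" and K :: "'n set" and \<rho> :: "'n \<Rightarrow> nat"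
  assumes A: "finite A" "A \<subseteq> carrier N"
    and F_add: "\<And>e x y. x \<in> carrier N \<Longrightarrow> y \<in> carrier N \<Longrightarrow> F e (x \<oplus>\<^bsub>N\<^esub> y) = F e x + F e y"
    and K_iff: "\<And>x. x \<in> K \<longleftrightarrow> x \<in> carrier N \<and> (\<forall>e. F e x = 0)"
    and K_act: "\<And>g x. g \<in> carrier G \<Longrightarrow> x \<in> K \<Longrightarrow> act g x \<in> K"
    and finite_faces: "\<And>b. b \<in> signed_orbits G N A \<Longrightarrow> finite {e. F e b \<noteq> 0}"
    and finite_cofaces: "\<And>e. finite {b \<in> signed_orbits G N A. F e b \<noteq> 0}"
    and \<rho>: "invariant_norm_on G N K \<rho>"
begin

abbreviation "letters \<equiv> signed_orbits G N A"

lemma letters_carrier: "set L \<subseteq> letters \<Longrightarrow> set L \<subseteq> carrier N"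
  using signed_orbits_subset[OF A(2)] by (rule subset_trans[rotated])

text \<open>The letters whose boundary has a cell in common with the boundary of a letter in \<open>S\<close>; they
  include the letters of \<open>S\<close> with nonzero boundary.\<close>

definition adjacent :: "'n set \<Rightarrow> 'n set" where
  "adjacent S = {b \<in> letters. \<exists>a\<in>S. \<exists>e. F e a \<noteq> 0 \<and> F e b \<noteq> 0}"

lemma finite_adjacent:
  assumes "finite S" "S \<subseteq> letters"
  shows "finite (adjacent S)"
proof (rule finite_subset)
  show "adjacent S \<subseteq> (\<Union>a\<in>S. \<Union>e\<in>{e. F e a \<noteq> 0}. {b \<in> letters. F e b \<noteq> 0})"
    unfolding adjacent_def by blast
  show "finite (\<Union>a\<in>S. \<Union>e\<in>{e. F e a \<noteq> 0}. {b \<in> letters. F e b \<noteq> 0})"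
    using assms finite_faces finite_cofaces by (intro finite_UN_I) (auto simp: subset_iff)
qed

text \<open>If no letter of a cycle outside \<open>S\<close> is adjacent to \<open>S\<close>, then the letters inside \<open>S\<close> and those
  outside \<open>S\<close> have boundaries without common cells, so these cannot cancel each other and both
  vanish.\<close>

lemma cycle_splits:
  assumes L: "set L \<subseteq> letters" "list_sum N L \<in> K" and S: "set L \<inter> adjacent S \<subseteq> S"
  shows "list_sum N (filter (\<lambda>b. b \<in> S) L) \<in> K" "list_sum N (filter (\<lambda>b. b \<notin> S) L) \<in> K"
proof -
  let ?L1 = "filter (\<lambda>b. b \<in> S) L" and ?L2 = "filter (\<lambda>b. b \<notin> S) L"
  have LN: "set L \<subseteq> carrier N" by (rule letters_carrier[OF L(1)])
  hence sub: "set ?L1 \<subseteq> carrier N" "set ?L2 \<subseteq> carrier N" by (simp_all add: subset_iff)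
  have clo: "list_sum N ?L1 \<in> carrier N" "list_sum N ?L2 \<in> carrier N"
    by (rule M.list_sum_closed[OF sub(1)], rule M.list_sum_closed[OF sub(2)])
  have "F e (list_sum N ?L1) = 0 \<and> F e (list_sum N ?L2) = 0" for e
  proof -
    have total: "F e (list_sum N ?L1) + F e (list_sum N ?L2) = 0"
      using L(2) K_iff F_add[OF clo] M.list_sum_partition[OF LN, of "\<lambda>b. b \<in> S"] by simp
    have "F e (list_sum N ?L1) = 0 \<or> F e (list_sum N ?L2) = 0"
    proof (cases "\<exists>a\<in>set ?L1. F e a \<noteq> 0")
      case False
      thus ?thesis using M.additive_list_sum[of "F e", OF F_add sub(1)] by blast
    next
      case True
      then obtain a where a: "a \<in> S" "F e a \<noteq> 0" by auto
      have "F e b = 0" if "b \<in> set ?L2" for b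
      proof (rule ccontr)
        assume "F e b \<noteq> 0"
        moreover have b: "b \<in> set L" "b \<notin> S" using that by simp_all
        ultimately have "b \<in> adjacent S" using a subsetD[OF L(1)] unfolding adjacent_def by blast
        thus False using S b by blast
      qed
      thus ?thesis using M.additive_list_sum[of "F e", OF F_add sub(2)] by blast
    qed
    thus ?thesis using total by auto
  qed
  thus "list_sum N ?L1 \<in> K" "list_sum N ?L2 \<in> K" using clo by (simp_all add: K_iff)
qed

text \<open>The induction is on the number \<open>n\<close> of letters that the word has outside the finite set \<open>S\<close>.
  Either the word has a letter adjacent to \<open>S\<close>, and then enlarging \<open>S\<close> to a set that is still
  finite decreases \<open>n\<close>; or the word splits into two cycles, one with letters in \<open>S\<close> and the other
  one shorter because the word meets \<open>S\<close>. With all letters in \<open>S\<close> there are only finitely many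
  words of bounded length.\<close>

lemma cycles_meeting_finite_set_bounded:
  assumes shorter: "\<And>L. set L \<subseteq> letters \<Longrightarrow> length L \<le> k \<Longrightarrow> list_sum N L \<in> K \<Longrightarrow> \<rho> (list_sum N L) \<le> B"
    and S: "finite S" "S \<subseteq> letters"
  shows "\<exists>C. \<forall>L. set L \<subseteq> letters \<and> length L \<le> Suc k \<and> list_sum N L \<in> K \<and> set L \<inter> S \<noteq> {} \<and>
    length (filter (\<lambda>b. b \<notin> S) L) \<le> n \<longrightarrow> \<rho> (list_sum N L) \<le> C"
  using S
proof (induction n arbitrary: S)
  case 0
  let ?W = "{L. set L \<subseteq> S \<and> length L \<le> Suc k}"
  have "finite ((\<lambda>L. \<rho> (list_sum N L)) ` ?W)"
    using finite_lists_length_le[OF 0(1)] by (rule finite_imageI)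
  then obtain C where C: "\<forall>m\<in>(\<lambda>L. \<rho> (list_sum N L)) ` ?W. m \<le> C"
    unfolding finite_nat_set_iff_bounded_le by (elim exE)
  have "\<rho> (list_sum N L) \<le> C" if "length L \<le> Suc k" "length (filter (\<lambda>b. b \<notin> S) L) \<le> 0" for L
  proof -
    have "set L \<subseteq> S" using that(2) by (auto simp: filter_empty_conv)
    thus ?thesis using that(1) C by blast
  qed
  thus ?case by blast
next
  case (Suc n)
  let ?S' = "S \<union> adjacent S"
  have S': "finite ?S'" "?S' \<subseteq> letters"
    using Suc.prems finite_adjacent by (auto simp: adjacent_def)
  obtain C1 where C1: "\<And>L. set L \<subseteq> letters \<Longrightarrow> length L \<le> Suc k \<Longrightarrow> list_sum N L \<in> K \<Longrightarrow>
    set L \<inter> ?S' \<noteq> {} \<Longrightarrow> length (filter (\<lambda>b. b \<notin> ?S') L) \<le> n \<Longrightarrow> \<rho> (list_sum N L) \<le> C1"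
    using Suc.IH[OF S'] by blast
  obtain C2 where C2: "\<And>L. set L \<subseteq> letters \<Longrightarrow> length L \<le> Suc k \<Longrightarrow> list_sum N L \<in> K \<Longrightarrow>
    set L \<inter> S \<noteq> {} \<Longrightarrow> length (filter (\<lambda>b. b \<notin> S) L) \<le> n \<Longrightarrow> \<rho> (list_sum N L) \<le> C2"
    using Suc.IH[OF Suc.prems] by blast
  have "\<rho> (list_sum N L) \<le> C1 + C2 + B"
    if L: "set L \<subseteq> letters" "length L \<le> Suc k" "list_sum N L \<in> K" "set L \<inter> S \<noteq> {}"
      "length (filter (\<lambda>b. b \<notin> S) L) \<le> Suc n" for L
  proof (cases "set L \<inter> adjacent S \<subseteq> S")
    case False
    then obtain b where b: "b \<in> set L" "b \<in> adjacent S" "b \<notin> S" by blast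
    have "filter (\<lambda>b. b \<notin> ?S') L = filter (\<lambda>b. b \<notin> adjacent S) (filter (\<lambda>b. b \<notin> S) L)"
      by (simp add: conj_commute)
    also have "length \<dots> < length (filter (\<lambda>b. b \<notin> S) L)"
      by (rule length_filter_less[of b]) (use b in auto)
    finally have "length (filter (\<lambda>b. b \<notin> ?S') L) \<le> n" using L(5) by simp
    hence "\<rho> (list_sum N L) \<le> C1" using C1[OF L(1-3)] L(4) by blast
    thus ?thesis by simp
  next
    case True
    let ?L1 = "filter (\<lambda>b. b \<in> S) L" and ?L2 = "filter (\<lambda>b. b \<notin> S) L"
    note split = cycle_splits[OF L(1,3) True]
    have sub: "set ?L1 \<subseteq> letters" "set ?L2 \<subseteq> letters" using L(1) by (simp_all add: subset_iff)
    obtain a where a: "a \<in> set L" "a \<in> S" using L(4) by blast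
    have len1: "length ?L1 \<le> Suc k" by (rule le_trans[OF length_filter_le L(2)])
    have "length ?L2 < length L" by (rule length_filter_less[of a]) (use a in auto)
    hence len2: "length ?L2 \<le> k" using L(2) by simp
    have "list_sum N L = list_sum N ?L1 \<oplus>\<^bsub>N\<^esub> list_sum N ?L2"
      by (rule M.list_sum_partition[OF letters_carrier[OF L(1)]])
    hence "\<rho> (list_sum N L) \<le> \<rho> (list_sum N ?L1) + \<rho> (list_sum N ?L2)"
      using invariant_norm_onD(2)[OF \<rho> split] by simp
    also have "\<rho> (list_sum N ?L1) \<le> C2"
      by (rule C2[OF sub(1) len1 split(1)]) (use a in auto)
    also have "\<rho> (list_sum N ?L2) \<le> B" by (rule shorter[OF sub(2) len2 split(2)])
    finally show ?thesis by simp
  qed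
  thus ?case by blast
qed

text \<open>Cycles of bounded length need not be finite in number up to translation, as the parts of a
  disconnected cycle can be translated independently; only their norm is bounded. A translate of a nonempty word contains
  one of finitely many letters, so that the preceding lemma applies.\<close>

lemma short_cycles_bounded:
  "\<exists>B. \<forall>L. set L \<subseteq> letters \<and> length L \<le> k \<and> list_sum N L \<in> K \<longrightarrow> \<rho> (list_sum N L) \<le> B"
proof (induction k)
  case 0
  have "\<rho> (list_sum N L) \<le> 0" if "length L \<le> 0" for L
    using that invariant_norm_onD(1)[OF \<rho>] by simp
  thus ?case by blast
next
  case (Suc k)
  then obtain B where B: "\<And>L. set L \<subseteq> letters \<Longrightarrow> length L \<le> k \<Longrightarrow> list_sum N L \<in> K \<Longrightarrow>
    \<rho> (list_sum N L) \<le> B" by blast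
  define S where "S = A \<union> (\<lambda>a. \<ominus>\<^bsub>N\<^esub> a) ` A"
  have "finite S" using A(1) by (simp add: S_def)
  moreover have "S \<subseteq> letters"
  proof
    fix b assume "b \<in> S"
    then obtain a where a: "a \<in> A" "b = a \<or> b = \<ominus>\<^bsub>N\<^esub> a" by (auto simp: S_def)
    have "act \<one> a = a" using a(1) A(2) by (simp add: act_one subset_iff)
    hence "b \<in> {act \<one> a, \<ominus>\<^bsub>N\<^esub> act \<one> a}" using a(2) by auto
    thus "b \<in> letters" unfolding signed_orbits_def using a(1) one_closed by blast
  qed
  ultimately obtain C where C: "\<And>L. set L \<subseteq> letters \<Longrightarrow> length L \<le> Suc k \<Longrightarrow> list_sum N L \<in> K \<Longrightarrow>
      set L \<inter> S \<noteq> {} \<Longrightarrow> length (filter (\<lambda>b. b \<notin> S) L) \<le> Suc k \<Longrightarrow> \<rho> (list_sum N L) \<le> C"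
    using cycles_meeting_finite_set_bounded[OF B, where S = S and n = "Suc k"] by blast
  have "\<rho> (list_sum N L) \<le> C"
    if L: "set L \<subseteq> letters" "length L \<le> Suc k" "list_sum N L \<in> K" for L
  proof (cases L)
    case Nil
    thus ?thesis using invariant_norm_onD(1)[OF \<rho>] by simp
  next
    case (Cons b L')
    have "b \<in> letters" using L(1) Cons by simp
    then obtain g a where g: "g \<in> carrier G" "a \<in> A" "b = act g a \<or> b = \<ominus>\<^bsub>N\<^esub> act g a"
      unfolding signed_orbits_def by blast
    have ig: "inv g \<in> carrier G" using g(1) by simp
    have a: "a \<in> carrier N" using g(2) A(2) by blast
    let ?T = "map (act (inv g)) L"
    have LN: "set L \<subseteq> carrier N" by (rule letters_carrier[OF L(1)])
    have T: "list_sum N ?T = act (inv g) (list_sum N L)"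
      by (rule smult_list_sum[symmetric]) (use ig LN in auto)
    have "act (inv g) b = a \<or> act (inv g) b = \<ominus>\<^bsub>N\<^esub> a"
      using g(1,3) ig a by (auto simp: act_act act_one smult_neg)
    hence "act (inv g) b \<in> S" using g(2) by (auto simp: S_def)
    hence meet: "set ?T \<inter> S \<noteq> {}" by (simp add: Cons)
    have TK: "list_sum N ?T \<in> K" unfolding T by (rule K_act[OF ig L(3)])
    have "\<rho> (list_sum N ?T) \<le> C"
    proof (rule C[OF _ _ TK meet])
      show "set ?T \<subseteq> letters"
        unfolding set_map by (rule image_subsetI) (rule signed_orbits_act[OF A(2) ig subsetD[OF L(1)]])
      show "length ?T \<le> Suc k" using L(2) by simp
      show "length (filter (\<lambda>b. b \<notin> S) ?T) \<le> Suc k"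
        using L(2) le_trans[OF length_filter_le] by (metis length_map)
    qed
    moreover have "act g (list_sum N ?T) = list_sum N L"
      unfolding T using M.list_sum_closed[OF LN] g(1) ig by (simp add: act_act act_one)
    ultimately show ?thesis using invariant_norm_onD(4)[OF \<rho> g(1) TK] by simp
  qed
  thus ?case by blast
qed

end

section \<open>Finiteness of fillings\<close>

text \<open>Lifting the identity along the canonical surjection from the free module on \<open>carrier P\<close>
  gives a section. The free module may have infinite rank, which does no harm: only the finiteness
  of the supports of its elements matters below.\<close>

lemma projective_embeds_in_free:
  fixes P :: "('r, 'p) module"
  assumes P: "left_module R P" "projective R P"
  obtains s where "s \<in> linear_maps R P (free_module_on R (carrier P))" "inj_on s (carrier P)"
proof -
  interpret P: left_module R P by fact
  let ?F = "free_module_on R (carrier P)"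
  have F: "left_module R ?F" by (rule left_module_free_module_on) (rule P.R.ring_axioms)
  let ?e = "free_eval R P (\<lambda>p. p)"
  have e: "?e \<in> linear_maps R ?F P"
    by (rule free_eval_linear[OF P(1)]) simp
  have "carrier P \<subseteq> ?e ` carrier ?F"
  proof
    fix p assume p: "p \<in> carrier P"
    define c where "c = (\<lambda>q. if q = p then \<one>\<^bsub>R\<^esub> else \<zero>\<^bsub>R\<^esub>)"
    have c: "c \<in> carrier ?F" "{q. c q \<noteq> \<zero>\<^bsub>R\<^esub>} \<subseteq> {p}"
      using p by (auto simp: c_def free_module_on_def)
    have "?e c = (\<Oplus>\<^bsub>P\<^esub>q\<in>{p}. c q \<odot>\<^bsub>P\<^esub> q)"
      by (rule free_eval_eq[OF P(1) _ c(1) _ c(2)]) (use p in auto)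
    also have "\<dots> = p" using p by (simp add: c_def)
    finally show "p \<in> ?e ` carrier ?F" using c(1) by (metis image_eqI)
  qed
  hence surj: "?e ` carrier ?F = carrier P" using linear_maps_closed[OF e] by blast
  have id: "(\<lambda>x. x) \<in> linear_maps R P P" by (rule linear_mapsI) simp_all
  obtain s where s: "s \<in> linear_maps R P ?F" "\<forall>x\<in>carrier P. ?e (s x) = x"
    using projective_lift[OF P F P(1) e surj id] by (elim bexE)
  have "inj_on s (carrier P)" using s(2) by (intro inj_on_inverseI[of _ ?e]) simp
  thus ?thesis using s(1) that by simp
qed

lemma group_ring_outside: "a \<in> carrier (group_ring G) \<Longrightarrow> x \<notin> carrier G \<Longrightarrow> a x = 0"
  unfolding group_ring_carrier_iff by blast

text \<open>The cells are the pairs of a basis element \<open>p\<close> and a group element \<open>h\<close>. A translate \<open>g \<cdot> a\<close> has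
  \<open>(p, h)\<close> in its boundary exactly if \<open>a\<close> has \<open>(p, inv g \<otimes> h)\<close> in its own, which leaves finitely many
  choices for \<open>g\<close>.\<close>

lemma locally_finite_boundary_of_map_to_free:
  fixes X :: "'p set"
  assumes N: "group_module G N" and t: "t \<in> linear_maps (group_ring G) N (free_module_on (group_ring G) X)"
    and A: "finite A" "A \<subseteq> carrier N"
    and K: "K = {x \<in> carrier N. t x = \<zero>\<^bsub>free_module_on (group_ring G) X\<^esub>}"
    and \<rho>: "invariant_norm_on G N K \<rho>"
  shows "locally_finite_boundary G N A (\<lambda>e x. t x (fst e) (snd e)) K \<rho>"
proof -
  interpret N: group_module G N by fact
  have mon: "monoid G" by (rule group.is_monoid[OF group_module.axioms(1)[OF N]])
  let ?R = "group_ring G"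
  let ?F = "free_module_on ?R X"
  have F: "left_module ?R ?F" by (rule left_module_free_module_on[OF N.R.ring_axioms])
  interpret F: left_module ?R ?F by (rule F)
  have F_simps: "\<zero>\<^bsub>?F\<^esub> = (\<lambda>p. \<zero>\<^bsub>?R\<^esub>)" "\<And>c d p. (c \<oplus>\<^bsub>?F\<^esub> d) p = c p \<oplus>\<^bsub>?R\<^esub> d p"
      "\<And>a c p. (a \<odot>\<^bsub>?F\<^esub> c) p = a \<otimes>\<^bsub>?R\<^esub> c p"
    by (simp_all add: free_module_on_def)
  have tF: "finite {p. t x p \<noteq> \<zero>\<^bsub>?R\<^esub>}" "t x p \<in> carrier ?R" if "x \<in> carrier N" for x p
    using linear_maps_closed[OF t that] by (auto simp: free_module_on_def)
  have t_zero: "t x = \<zero>\<^bsub>?F\<^esub> \<longleftrightarrow> (\<forall>e. t x (fst e) (snd e) = 0)" for x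
    by (auto simp: F_simps fun_eq_iff)
  have t_neg: "t (\<ominus>\<^bsub>N\<^esub> x) p h = - t x p h" if x: "x \<in> carrier N" for x p h
  proof -
    have "t (\<ominus>\<^bsub>N\<^esub> x \<oplus>\<^bsub>N\<^esub> x) p h = 0"
      using x linear_maps_zero[OF N.left_module_axioms F t] by (simp add: N.M.l_neg F_simps)
    thus ?thesis using x by (simp add: linear_maps_add[OF t] F_simps)
  qed
  have t_act: "t (N.act g x) p h = t x p (inv\<^bsub>G\<^esub> g \<otimes>\<^bsub>G\<^esub> h)"
    if "g \<in> carrier G" "x \<in> carrier N" "h \<in> carrier G" for g x p h
    using that by (simp add: linear_maps_smult[OF t] F_simps N.group_ring_of_mult_left tF)
  show ?thesis
  proof (intro locally_finite_boundary.intro N locally_finite_boundary_axioms.intro A \<rho>)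
    show "t (x \<oplus>\<^bsub>N\<^esub> y) (fst e) (snd e) =
        t x (fst e) (snd e) + t y (fst e) (snd e)"
      if "x \<in> carrier N" "y \<in> carrier N" for e x y
      using that by (simp add: linear_maps_add[OF t] F_simps)
    show "x \<in> K \<longleftrightarrow> x \<in> carrier N \<and> (\<forall>e. t x (fst e) (snd e) = 0)" for x
      unfolding K by (simp only: t_zero mem_Collect_eq)
    show "N.act g x \<in> K" if "g \<in> carrier G" "x \<in> K" for g x
      using that unfolding K by (simp add: linear_maps_smult[OF t])
  next
    fix b assume "b \<in> signed_orbits G N A"
    hence b: "b \<in> carrier N" using N.signed_orbits_subset[OF A(2)] by (rule subsetD[rotated])
    have "finite {h. t b p h \<noteq> 0}" for p using tF(2)[OF b] by (simp add: group_ring_carrier_iff)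
    hence fin: "finite (Sigma {p. t b p \<noteq> \<zero>\<^bsub>?R\<^esub>} (\<lambda>p. {h. t b p h \<noteq> 0}))"
      using tF(1)[OF b] by (intro finite_SigmaI)
    have "{e. t b (fst e) (snd e) \<noteq> 0} \<subseteq>
        Sigma {p. t b p \<noteq> \<zero>\<^bsub>?R\<^esub>} (\<lambda>p. {h. t b p h \<noteq> 0})"
    proof
      fix e assume "e \<in> {e. t b (fst e) (snd e) \<noteq> 0}"
      moreover obtain p h where e: "e = (p, h)" by (cases e)
      ultimately have "t b p h \<noteq> 0" by simp
      moreover from this have "t b p \<noteq> \<zero>\<^bsub>?R\<^esub>" by (metis group_ring_simps(2))
      ultimately show "e \<in> Sigma {p. t b p \<noteq> \<zero>\<^bsub>?R\<^esub>} (\<lambda>p. {h. t b p h \<noteq> 0})"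
        by (simp add: e)
    qed
    thus "finite {e. t b (fst e) (snd e) \<noteq> 0}" by (rule finite_subset[OF _ fin])
  next
    fix e :: "'p \<times> 'a"
    obtain p h where e: "e = (p, h)" by (cases e)
    let ?b = "\<lambda>a u. N.act (h \<otimes>\<^bsub>G\<^esub> inv\<^bsub>G\<^esub> u) a"
    let ?U = "\<Union>a\<in>A. \<Union>u\<in>{u. t a p u \<noteq> 0}. {?b a u, \<ominus>\<^bsub>N\<^esub> ?b a u}"
    have "finite {u. t a p u \<noteq> 0}" if "a \<in> A" for a
      using tF(2)[OF subsetD[OF A(2) that], of p] by (simp add: group_ring_carrier_iff)
    hence fin: "finite ?U" using A(1) by simp
    have "b \<in> ?U" if b: "b \<in> signed_orbits G N A" "t b p h \<noteq> 0" for b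
    proof -
      obtain g a where g: "g \<in> carrier G" "a \<in> A" "b = N.act g a \<or> b = \<ominus>\<^bsub>N\<^esub> N.act g a"
        using b(1) by (auto simp: signed_orbits_def)
      have a: "a \<in> carrier N" "N.act g a \<in> carrier N" using g A(2) by auto
      have nz: "t (N.act g a) p h \<noteq> 0" using b(2) g(3) t_neg[OF a(2)] by auto
      have h: "h \<in> carrier G" using group_ring_outside[OF tF(2)[OF a(2)]] nz by metis
      define u where "u = inv\<^bsub>G\<^esub> g \<otimes>\<^bsub>G\<^esub> h"
      have u: "t a p u \<noteq> 0" using nz t_act[OF g(1) a(1) h] by (simp add: u_def)
      have "h \<otimes>\<^bsub>G\<^esub> inv\<^bsub>G\<^esub> u = g"
        using g(1) h by (simp add: u_def N.inv_mult_group monoid.m_assoc[OF mon, symmetric])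
      hence "b \<in> {?b a u, \<ominus>\<^bsub>N\<^esub> ?b a u}" using g(3) by simp
      thus ?thesis using g(2) u by blast
    qed
    hence "{b \<in> signed_orbits G N A. t b (fst e) (snd e) \<noteq> 0} \<subseteq> ?U" by (auto simp: e)
    thus "finite {b \<in> signed_orbits G N A. t b (fst e) (snd e) \<noteq> 0}"
      by (rule finite_subset[OF _ fin])
  qed
qed

text \<open>Embedding \<open>N0\<close> in a free module gives the cycles of \<open>N1\<close> a locally finite boundary. Every cycle
  of norm at most \<open>k\<close> is a word of at most \<open>k\<close> letters, and the norm of fillings is invariant on
  the cycles.\<close>

lemma fillings_of_bounded_cycles_bounded:
  fixes N0 :: "('g \<Rightarrow> int, 'p) module" and N1 :: "('g \<Rightarrow> int, 'p1) module"
    and N2 :: "('g \<Rightarrow> int, 'p2) module"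
  assumes mods: "group_module G N0" "group_module G N1" "group_module G N2"
    and proj: "projective (group_ring G) N0"
    and \<phi>1: "\<phi>1 \<in> linear_maps (group_ring G) N1 N0"
    and \<phi>2: "\<phi>2 \<in> linear_maps (group_ring G) N2 N1"
    and exact: "\<phi>2 ` carrier N2 = a_kernel N1 N0 \<phi>1"
    and \<nu>: "filling_norm TYPE('f) TYPE('i) G N1 \<nu>"
    and \<nu>': "invariant_norm_on G N2 (carrier N2) \<nu>'"
  shows "\<exists>B. \<forall>x\<in>a_kernel N1 N0 \<phi>1. \<nu> x \<le> k \<longrightarrow> induced_norm N2 \<nu>' \<phi>2 x \<le> B"
proof -
  interpret N0: group_module G N0 by fact
  interpret N1: group_module G N1 by fact
  interpret N2: group_module G N2 by fact
  let ?R = "group_ring G"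
  let ?K = "a_kernel N1 N0 \<phi>1" and ?F = "free_module_on ?R (carrier N0)"
  obtain s where s: "s \<in> linear_maps ?R N0 ?F" "inj_on s (carrier N0)"
    by (rule projective_embeds_in_free[OF N0.left_module_axioms proj])
  have F: "left_module ?R ?F" by (rule left_module_free_module_on[OF N0.R.ring_axioms])
  have t: "(\<lambda>x. s (\<phi>1 x)) \<in> linear_maps ?R N1 ?F"
    by (rule linear_mapsI)
       (simp_all add: linear_maps_closed[OF s(1)] linear_maps_closed[OF \<phi>1] linear_maps_add[OF s(1)]
         linear_maps_add[OF \<phi>1] linear_maps_smult[OF s(1)] linear_maps_smult[OF \<phi>1])
  have s0: "s \<zero>\<^bsub>N0\<^esub> = \<zero>\<^bsub>?F\<^esub>" by (rule linear_maps_zero[OF N0.left_module_axioms F s(1)])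
  have K: "?K = {x \<in> carrier N1. s (\<phi>1 x) = \<zero>\<^bsub>?F\<^esub>}"
    unfolding a_kernel_def' s0[symmetric]
    using inj_on_eq_iff[OF s(2) linear_maps_closed[OF \<phi>1] N0.M.zero_closed] by auto
  have \<rho>: "invariant_norm_on G N1 ?K (induced_norm N2 \<nu>' \<phi>2)"
    using induced_norm_invariant[OF mods(3,2) \<phi>2 \<nu>'] unfolding exact .
  obtain A where gens: "finite A" "A \<subseteq> carrier N1" "\<forall>x\<in>carrier N1. \<exists>L.
      set L \<subseteq> signed_orbits G N1 A \<and> length L = \<nu> x \<and> list_sum N1 L = x"
    using filling_norm_properties(2)[OF mods(2) \<nu>] by (elim exE conjE) (rule that)
  interpret cycles: locally_finite_boundary G N1 A "\<lambda>e x. s (\<phi>1 x) (fst e) (snd e)" ?K "induced_norm N2 \<nu>' \<phi>2"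
    by (rule locally_finite_boundary_of_map_to_free[OF mods(2) t gens(1,2) K \<rho>])
  obtain B where B: "\<forall>L. set L \<subseteq> signed_orbits G N1 A \<and> length L \<le> k \<and> list_sum N1 L \<in> ?K \<longrightarrow>
      induced_norm N2 \<nu>' \<phi>2 (list_sum N1 L) \<le> B"
    using cycles.short_cycles_bounded ..
  show ?thesis
  proof (intro exI ballI impI)
    fix x assume x: "x \<in> ?K" "\<nu> x \<le> k"
    hence "x \<in> carrier N1" by (simp add: a_kernel_def')
    then obtain L where L: "set L \<subseteq> signed_orbits G N1 A" "length L = \<nu> x" "list_sum N1 L = x"
      using gens(3) by blast
    thus "induced_norm N2 \<nu>' \<phi>2 x \<le> B" using B[rule_format, of L] x by simp
  qed
qed

section \<open>Resolutions up to homotopy\<close>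

lemma linear_maps_compose:
  "f \<in> linear_maps R M N \<Longrightarrow> g \<in> linear_maps R N L \<Longrightarrow> (\<lambda>x. g (f x)) \<in> linear_maps R M L"
  by (rule linear_mapsI) (simp_all add: linear_maps_closed linear_maps_add linear_maps_smult)

lemma linear_maps_diff:
  assumes N: "left_module R N" and f: "f \<in> linear_maps R M N" and g: "g \<in> linear_maps R M N"
  shows "(\<lambda>x. f x \<ominus>\<^bsub>N\<^esub> g x) \<in> linear_maps R M N"
proof -
  interpret N: left_module R N by fact
  note clo = linear_maps_closed[OF f] linear_maps_closed[OF g]
  show ?thesis
    by (rule linear_mapsI)
       (simp_all add: clo a_minus_def linear_maps_add[OF f] linear_maps_add[OF g]
         linear_maps_smult[OF f] linear_maps_smult[OF g] N.smult_r_distr N.smult_neg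
         N.M.minus_add N.M.a_ac)
qed

lemma left_module_image:
  assumes M: "left_module R M" and N: "left_module R N" and f: "f \<in> linear_maps R M N"
  shows "left_module R (N\<lparr>carrier := f ` carrier M\<rparr>)"
proof -
  interpret M: left_module R M by fact
  interpret N: left_module R N by fact
  let ?I = "N\<lparr>carrier := f ` carrier M\<rparr>"
  have NI: "x \<in> carrier N" if "x \<in> carrier ?I" for x
    using that linear_maps_closed[OF f] by auto
  have I: "f x \<in> carrier ?I" if "x \<in> carrier M" for x using that by simp
  show ?thesis
  proof (intro left_module.intro left_module_axioms.intro M.R.ring_axioms abelian_groupI)
    fix x y assume "x \<in> carrier ?I" "y \<in> carrier ?I"
    then obtain a b where "a \<in> carrier M" "x = f a" "b \<in> carrier M" "y = f b" by auto
    thus "x \<oplus>\<^bsub>?I\<^esub> y \<in> carrier ?I"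
      using I[of "a \<oplus>\<^bsub>M\<^esub> b"] by (simp add: linear_maps_add[OF f])
  next
    show "\<zero>\<^bsub>?I\<^esub> \<in> carrier ?I"
      using I[OF M.M.zero_closed] by (simp add: linear_maps_zero[OF M N f])
  next
    fix x assume x: "x \<in> carrier ?I"
    then obtain a where a: "a \<in> carrier M" "x = f a" by auto
    hence "\<ominus>\<^bsub>N\<^esub> x \<in> carrier ?I"
      using I[of "\<ominus>\<^bsub>M\<^esub> a"] by (simp add: linear_maps_neg[OF M N f])
    thus "\<exists>y\<in>carrier ?I. y \<oplus>\<^bsub>?I\<^esub> x = \<zero>\<^bsub>?I\<^esub>"
      by (rule bexI[rotated]) (simp add: N.M.l_neg NI[OF x])
  next
    fix r x assume r: "r \<in> carrier R" and "x \<in> carrier ?I"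
    then obtain a where "a \<in> carrier M" "x = f a" by auto
    thus "r \<odot>\<^bsub>?I\<^esub> x \<in> carrier ?I"
      using I[of "r \<odot>\<^bsub>M\<^esub> a"] r by (simp add: linear_maps_smult[OF f])
  qed (use NI in \<open>simp_all add: N.M.a_ac N.smult_l_distr N.smult_r_distr N.smult_assoc1\<close>)
qed

text \<open>The submodule \<open>g ` carrier N\<close> of \<open>N'\<close> takes the place of the target in the lifting property.
  It is in this form that projectivity and exactness are combined.\<close>

lemma projective_lift_into_image:
  fixes P :: "('r, 'p) module" and N :: "('r, 'n) module" and N' :: "('r, 'k) module"
  assumes P: "left_module R P" "projective R P" and N: "left_module R N" "left_module R N'"
    and g: "g \<in> linear_maps R N N'" and f: "f \<in> linear_maps R P N'"
    and sub: "f ` carrier P \<subseteq> g ` carrier N"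
  obtains h where "h \<in> linear_maps R P N" "\<And>x. x \<in> carrier P \<Longrightarrow> g (h x) = f x"
proof -
  let ?I = "N'\<lparr>carrier := g ` carrier N\<rparr>"
  have "g \<in> linear_maps R N ?I"
    by (rule linear_mapsI) (simp_all add: linear_maps_add[OF g] linear_maps_smult[OF g])
  moreover have "g ` carrier N = carrier ?I" by simp
  moreover have "f \<in> linear_maps R P ?I"
    using sub by (intro linear_mapsI) (auto simp: linear_maps_add[OF f] linear_maps_smult[OF f])
  ultimately have "\<exists>h\<in>linear_maps R P N. \<forall>x\<in>carrier P. g (h x) = f x"
    by (rule projective_lift[OF P N(1) left_module_image[OF N g]])
  thus ?thesis using that by (elim bexE) simp
qed

text \<open>One step of the comparison of two resolutions, where \<open>P0\<close>, \<open>P1\<close>, \<open>P2\<close> and \<open>Q0\<close>, \<open>Q1\<close> are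
  consecutive modules in them. The homotopy identity is kept on cycles only, where the usual
  term involving the preceding homotopy vanishes. For this reason an induction needs to remember
  only the latest maps \<open>f\<close>, \<open>g\<close> and \<open>h\<close>.\<close>

lemma comparison_maps_step:
  fixes P0 :: "('r, 'p0) module" and P1 P2 :: "('r, 'p) module"
    and Q0 :: "('r, 'q0) module" and Q1 :: "('r, 'q) module"
  assumes mods: "left_module R P0" "left_module R P1" "left_module R P2" "left_module R Q0" "left_module R Q1"
    and proj: "projective R P1" "projective R Q1"
    and a: "a \<in> linear_maps R P1 P0" and b: "b \<in> linear_maps R Q1 Q0"
    and c: "c \<in> linear_maps R P2 P1" "c ` carrier P2 = a_kernel P1 P0 a"
    and f: "f \<in> linear_maps R P0 Q0" "f ` a ` carrier P1 \<subseteq> b ` carrier Q1"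
    and g: "g \<in> linear_maps R Q0 P0" "g ` b ` carrier Q1 \<subseteq> a ` carrier P1"
    and h: "h \<in> linear_maps R P0 P1" "\<forall>x\<in>a ` carrier P1. g (f x) = x \<oplus>\<^bsub>P0\<^esub> a (h x)"
  shows "\<exists>f'\<in>linear_maps R P1 Q1. \<exists>g'\<in>linear_maps R Q1 P1. \<exists>h'\<in>linear_maps R P1 P2.
    f' ` a_kernel P1 P0 a \<subseteq> a_kernel Q1 Q0 b \<and> g' ` a_kernel Q1 Q0 b \<subseteq> a_kernel P1 P0 a \<and>
    (\<forall>x\<in>a_kernel P1 P0 a. g' (f' x) = x \<oplus>\<^bsub>P1\<^esub> c (h' x))"
proof -
  interpret P0: left_module R P0 by fact
  interpret P1: left_module R P1 by fact
  interpret P2: left_module R P2 by fact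
  interpret Q0: left_module R Q0 by fact
  have fa: "(\<lambda>x. f (a x)) \<in> linear_maps R P1 Q0" by (rule linear_maps_compose[OF a f(1)])
  have "(\<lambda>x. f (a x)) ` carrier P1 \<subseteq> b ` carrier Q1" using f(2) by (simp only: image_image)
  from projective_lift_into_image[OF mods(2) proj(1) mods(5,4) b fa this]
  obtain f' where f': "f' \<in> linear_maps R P1 Q1" "\<And>x. x \<in> carrier P1 \<Longrightarrow> b (f' x) = f (a x)" by blast
  have gb: "(\<lambda>x. g (b x)) \<in> linear_maps R Q1 P0" by (rule linear_maps_compose[OF b g(1)])
  have "(\<lambda>x. g (b x)) ` carrier Q1 \<subseteq> a ` carrier P1" using g(2) by (simp only: image_image)
  from projective_lift_into_image[OF mods(5) proj(2) mods(2,1) a gb this]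
  obtain g' where g': "g' \<in> linear_maps R Q1 P1" "\<And>x. x \<in> carrier Q1 \<Longrightarrow> a (g' x) = g (b x)" by blast
  have gf: "(\<lambda>x. g' (f' x)) \<in> linear_maps R P1 P1" by (rule linear_maps_compose[OF f'(1) g'(1)])
  have id: "(\<lambda>x. x) \<in> linear_maps R P1 P1" by (rule linear_mapsI) simp_all
  have ha: "(\<lambda>x. h (a x)) \<in> linear_maps R P1 P1" by (rule linear_maps_compose[OF a h(1)])
  \<comment> \<open>The defect of \<open>g' \<circ> f'\<close> from the identity, corrected by \<open>h \<circ> a\<close> so that \<open>a\<close> kills it on all of \<open>P1\<close>.\<close>
  define u where "u = (\<lambda>x. (g' (f' x) \<ominus>\<^bsub>P1\<^esub> x) \<ominus>\<^bsub>P1\<^esub> h (a x))"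
  have u: "u \<in> linear_maps R P1 P1"
    unfolding u_def by (rule linear_maps_diff[OF mods(2) linear_maps_diff[OF mods(2) gf id] ha])
  have a_neg: "a (\<ominus>\<^bsub>P1\<^esub> x) = \<ominus>\<^bsub>P0\<^esub> a x" if "x \<in> carrier P1" for x
    by (rule linear_maps_neg[OF mods(2,1) a that])
  have "u ` carrier P1 \<subseteq> c ` carrier P2" unfolding c(2) a_kernel_def'
  proof (rule image_subsetI, rule CollectI, rule conjI)
    fix x assume x: "x \<in> carrier P1"
    show "u x \<in> carrier P1" by (rule linear_maps_closed[OF u x])
    have clo: "a x \<in> carrier P0" "h (a x) \<in> carrier P1" "a (h (a x)) \<in> carrier P0"
      "f' x \<in> carrier Q1" "g' (f' x) \<in> carrier P1"
      using x linear_maps_closed[OF a] linear_maps_closed[OF h(1)] linear_maps_closed[OF f'(1)]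
        linear_maps_closed[OF g'(1)] by simp_all
    have "a (g' (f' x)) = g (f (a x))" using x clo by (simp add: g'(2) f'(2))
    also have "\<dots> = a x \<oplus>\<^bsub>P0\<^esub> a (h (a x))" using h(2) x by simp
    finally have "a (u x) = ((a x \<oplus>\<^bsub>P0\<^esub> a (h (a x))) \<oplus>\<^bsub>P0\<^esub> \<ominus>\<^bsub>P0\<^esub> a x) \<oplus>\<^bsub>P0\<^esub> \<ominus>\<^bsub>P0\<^esub> a (h (a x))"
      using x clo by (simp add: u_def a_minus_def linear_maps_add[OF a] a_neg)
    also have "\<dots> = \<zero>\<^bsub>P0\<^esub>"
      using clo by (simp add: P0.M.a_ac P0.M.r_neg P0.M.r_neg1 P0.M.r_neg2)
    finally show "a (u x) = \<zero>\<^bsub>P0\<^esub>" .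
  qed
  from projective_lift_into_image[OF mods(2) proj(1) mods(3,2) c(1) u this]
  obtain h' where h': "h' \<in> linear_maps R P1 P2" "\<And>x. x \<in> carrier P1 \<Longrightarrow> c (h' x) = u x" by blast
  show ?thesis
  proof (intro bexI conjI ballI image_subsetI)
    fix x assume "x \<in> a_kernel P1 P0 a"
    hence x: "x \<in> carrier P1" "a x = \<zero>\<^bsub>P0\<^esub>" by (simp_all add: a_kernel_def')
    have clo: "f' x \<in> carrier Q1" "g' (f' x) \<in> carrier P1"
      using x linear_maps_closed[OF f'(1)] linear_maps_closed[OF g'(1)] by simp_all
    show "f' x \<in> a_kernel Q1 Q0 b"
      using x clo by (simp add: a_kernel_def' f'(2) linear_maps_zero[OF mods(1,4) f(1)])
    have "c (h' x) = g' (f' x) \<ominus>\<^bsub>P1\<^esub> x"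
      using x clo by (simp add: h'(2) u_def linear_maps_zero[OF mods(1,2) h(1)] a_minus_def)
    thus "g' (f' x) = x \<oplus>\<^bsub>P1\<^esub> c (h' x)"
      using x clo by (simp add: a_minus_def P1.M.a_ac P1.M.r_neg1 P1.M.r_neg2 P1.M.r_neg)
  next
    fix y assume "y \<in> a_kernel Q1 Q0 b"
    hence y: "y \<in> carrier Q1" "b y = \<zero>\<^bsub>Q0\<^esub>" by (simp_all add: a_kernel_def')
    show "g' y \<in> a_kernel P1 P0 a"
      using y by (simp add: a_kernel_def' g'(2) linear_maps_closed[OF g'(1)] linear_maps_zero[OF mods(4,1) g(1)])
  qed (fact f'(1) g'(1) h'(1))+
qed

lemma FP_resolutionD:
  assumes "FP_resolution R n M P \<phi> \<epsilon>"
  shows "i \<le> n \<Longrightarrow> left_module R (P i)" "i \<le> n \<Longrightarrow> projective R (P i)"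
    and "i < n \<Longrightarrow> \<phi> (Suc i) \<in> linear_maps R (P (Suc i)) (P i)"
    and "\<epsilon> \<in> linear_maps R (P 0) M" "\<epsilon> ` carrier (P 0) = carrier M"
    and "0 < n \<Longrightarrow> \<phi> (Suc 0) ` carrier (P (Suc 0)) = a_kernel (P 0) M \<epsilon>"
    and "Suc i < n \<Longrightarrow> \<phi> (Suc (Suc i)) ` carrier (P (Suc (Suc i))) = a_kernel (P (Suc i)) (P i) (\<phi> (Suc i))"
  using assms unfolding FP_resolution_def by simp_all

text \<open>The step lemma also starts the induction: one degree below \<open>P 0\<close> and \<open>Q 0\<close> both resolutions
  have the module \<open>M\<close>, on which the identity maps and the zero homotopy serve.\<close>

lemma resolution_comparison_maps:
  fixes M :: "('r, 'm) module" and P :: "nat \<Rightarrow> ('r, 'p) module" and Q :: "nat \<Rightarrow> ('r, 'q) module"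
  assumes M: "left_module R M" and P: "FP_resolution R (Suc d) M P \<phi> \<epsilon>"
    and Q: "FP_resolution R (Suc d) M Q \<psi> \<delta>"
  defines "Z \<equiv> \<lambda>i. \<phi> (Suc i) ` carrier (P (Suc i))" and "W \<equiv> \<lambda>i. \<psi> (Suc i) ` carrier (Q (Suc i))"
  assumes n: "n \<le> d"
  shows "\<exists>f\<in>linear_maps R (P n) (Q n). \<exists>g\<in>linear_maps R (Q n) (P n).
    \<exists>h\<in>linear_maps R (P n) (P (Suc n)). f ` Z n \<subseteq> W n \<and> g ` W n \<subseteq> Z n \<and>
      (\<forall>x\<in>Z n. g (f x) = x \<oplus>\<^bsub>P n\<^esub> \<phi> (Suc n) (h x))"
  using n
proof (induction n)
  case 0
  interpret M: left_module R M by fact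
  note P' = FP_resolutionD[OF P] and Q' = FP_resolutionD[OF Q]
  interpret P0: left_module R "P 0" using P'(1)[of 0] by simp
  have id: "(\<lambda>x. x) \<in> linear_maps R M M" by (rule linear_mapsI) simp_all
  have zero: "(\<lambda>x. \<zero>\<^bsub>P 0\<^esub>) \<in> linear_maps R M (P 0)" by (rule linear_mapsI) simp_all
  have mods: "left_module R (P 0)" "left_module R (P (Suc 0))" "left_module R (Q 0)"
    using P'(1)[of 0] P'(1)[of "Suc 0"] Q'(1)[of 0] by simp_all
  have proj: "projective R (P 0)" "projective R (Q 0)" using P'(2)[of 0] Q'(2)[of 0] by simp_all
  have \<epsilon>0: "\<epsilon> \<zero>\<^bsub>P 0\<^esub> = \<zero>\<^bsub>M\<^esub>" by (rule linear_maps_zero[OF mods(1) M P'(4)])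
  have ZW: "Z 0 = a_kernel (P 0) M \<epsilon>" "W 0 = a_kernel (Q 0) M \<delta>"
    using P'(6) Q'(6) by (simp_all add: Z_def W_def)
  show ?case unfolding ZW
  proof (rule comparison_maps_step[OF M mods(1,2) M mods(3) proj P'(4) Q'(4) _ _ id _ id _ zero])
    show "\<phi> (Suc 0) \<in> linear_maps R (P (Suc 0)) (P 0)" using P'(3)[of 0] by simp
    show "\<phi> (Suc 0) ` carrier (P (Suc 0)) = a_kernel (P 0) M \<epsilon>" using P'(6) by simp
  qed (simp_all add: P'(5) Q'(5) \<epsilon>0)
next
  case (Suc n)
  note P' = FP_resolutionD[OF P] and Q' = FP_resolutionD[OF Q]
  have n: "n < Suc d" "Suc n < Suc d" using Suc.prems by simp_all
  obtain f g h where IH: "f \<in> linear_maps R (P n) (Q n)" "g \<in> linear_maps R (Q n) (P n)"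
    "h \<in> linear_maps R (P n) (P (Suc n))" "f ` Z n \<subseteq> W n" "g ` W n \<subseteq> Z n"
    "\<forall>x\<in>Z n. g (f x) = x \<oplus>\<^bsub>P n\<^esub> \<phi> (Suc n) (h x)"
    using Suc.IH Suc.prems by (elim meta_impE bexE conjE) auto
  have ZW: "Z (Suc n) = a_kernel (P (Suc n)) (P n) (\<phi> (Suc n))"
    "W (Suc n) = a_kernel (Q (Suc n)) (Q n) (\<psi> (Suc n))"
    using P'(7)[OF n(2)] Q'(7)[OF n(2)] by (simp_all add: Z_def W_def)
  show ?case unfolding ZW
  proof (rule comparison_maps_step[where f = f and g = g and h = h])
    show "\<phi> (Suc (Suc n)) ` carrier (P (Suc (Suc n))) = a_kernel (P (Suc n)) (P n) (\<phi> (Suc n))"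
      by (rule P'(7)[OF n(2)])
    show "f ` \<phi> (Suc n) ` carrier (P (Suc n)) \<subseteq> \<psi> (Suc n) ` carrier (Q (Suc n))"
      "g ` \<psi> (Suc n) ` carrier (Q (Suc n)) \<subseteq> \<phi> (Suc n) ` carrier (P (Suc n))"
      "\<forall>x\<in>\<phi> (Suc n) ` carrier (P (Suc n)). g (f x) = x \<oplus>\<^bsub>P n\<^esub> \<phi> (Suc n) (h x)"
      using IH(4-6) unfolding Z_def W_def by simp_all
  qed (use n IH(1-3) P'(1-3) Q'(1-3) in simp_all)
qed

section \<open>Filling functions\<close>

lemma FP_resolution_group_module:
  assumes "group G" "FP_resolution (group_ring G) n M P \<phi> \<epsilon>" "i \<le> n"
  shows "group_module G (P i)"
  using assms FP_resolutionD(1)[OF assms(2,3)] by (simp add: group_module_iff)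

lemma filling_function_le_iff:
  "filling_function d P \<phi> \<nu>' \<nu> k \<le> enat b \<longleftrightarrow>
    (\<forall>x\<in>a_kernel (P d) (P (d - 1)) (\<phi> d). \<nu> x \<le> k \<longrightarrow>
      induced_norm (P (d + 1)) \<nu>' (\<phi> (d + 1)) x \<le> b)"
  unfolding filling_function_def by (auto simp: SUP_le_iff)

lemma filling_function_finite:
  fixes P :: "nat \<Rightarrow> ('g \<Rightarrow> int, 'p) module"
  assumes "group G" "d > 0" and P: "FP_resolution (group_ring G) (d + 1) M P \<phi> \<epsilon>"
    and \<nu>': "filling_norm TYPE('f1) TYPE('i1) G (P (d + 1)) \<nu>'"
    and \<nu>: "filling_norm TYPE('f2) TYPE('i2) G (P d) \<nu>"
  shows "filling_function d P \<phi> \<nu>' \<nu> k < \<infinity>"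
proof -
  obtain e where d: "d = Suc e" using assms(2) by (cases d) simp_all
  note mod = FP_resolution_group_module[OF assms(1) P]
  have mods: "group_module G (P e)" "group_module G (P (Suc e))" "group_module G (P (Suc (Suc e)))"
    using mod[of e] mod[of "Suc e"] mod[of "Suc (Suc e)"] by (simp_all add: d)
  have inv: "invariant_norm_on G (P (Suc (Suc e))) (carrier (P (Suc (Suc e)))) \<nu>'"
    using filling_norm_properties(1)[OF _ \<nu>'] mods(3) by (simp add: d)
  have "\<exists>B. \<forall>x\<in>a_kernel (P (Suc e)) (P e) (\<phi> (Suc e)). \<nu> x \<le> k \<longrightarrow>
      induced_norm (P (Suc (Suc e))) \<nu>' (\<phi> (Suc (Suc e))) x \<le> B"
    by (rule fillings_of_bounded_cycles_bounded[OF mods _ _ _ _ _ inv])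
       (use FP_resolutionD[OF P] \<nu> in \<open>simp_all add: d\<close>)
  then obtain B where "filling_function d P \<phi> \<nu>' \<nu> k \<le> enat B"
    unfolding filling_function_le_iff by (auto simp: d)
  thus ?thesis by (rule le_less_trans) simp
qed

lemma filling_function_mono:
  "j \<le> k \<Longrightarrow> filling_function d P \<phi> \<nu>' \<nu> j \<le> filling_function d P \<phi> \<nu>' \<nu> k"
  unfolding filling_function_def by (rule SUP_subset_mono) auto

text \<open>To fill a cycle \<open>x\<close> of \<open>P d\<close>, map it to a cycle \<open>f x\<close> of \<open>Q d\<close>, choose an optimal filling \<open>y\<close>
  there, and map \<open>y\<close> back to \<open>g' y\<close>. This fills \<open>g (f x)\<close> instead of \<open>x\<close>, and the homotopy term
  \<open>h x\<close> corrects the difference. The three maps are bounded, which gives the three constants.\<close>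

lemma filling_function_growth_le:
  fixes M :: "('g \<Rightarrow> int, 'm) module"
    and P :: "nat \<Rightarrow> ('g \<Rightarrow> int, 'p) module" and Q :: "nat \<Rightarrow> ('g \<Rightarrow> int, 'q) module"
  assumes "group G" "d > 0" and M: "left_module (group_ring G) M"
    and P: "FP_resolution (group_ring G) (d + 1) M P \<phi> \<epsilon>"
    and \<nu>': "filling_norm TYPE('f1) TYPE('i1) G (P (d + 1)) \<nu>'"
    and \<nu>: "filling_norm TYPE('f2) TYPE('i2) G (P d) \<nu>"
    and Q: "FP_resolution (group_ring G) (d + 1) M Q \<psi> \<delta>"
    and \<mu>': "filling_norm TYPE('f3) TYPE('i3) G (Q (d + 1)) \<mu>'"
    and \<mu>: "filling_norm TYPE('f4) TYPE('i4) G (Q d) \<mu>"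
  shows "growth_le (\<lambda>k. the_enat (filling_function d P \<phi> \<nu>' \<nu> k))
    (\<lambda>k. the_enat (filling_function d Q \<psi> \<mu>' \<mu> k))"
proof -
  let ?R = "group_ring G" and ?FP = "filling_function d P \<phi> \<nu>' \<nu>"
    and ?FQ = "filling_function d Q \<psi> \<mu>' \<mu>"
  have finite: "?FP k = enat (the_enat (?FP k))" "?FQ k = enat (the_enat (?FQ k))" for k
    using filling_function_finite[OF assms(1,2) P \<nu>' \<nu>, of k]
      filling_function_finite[OF assms(1,2) Q \<mu>' \<mu>, of k] by auto
  have gP: "group_module G (P d)" "group_module G (P (d + 1))"
    and gQ: "group_module G (Q d)" "group_module G (Q (d + 1))"
    using FP_resolution_group_module[OF assms(1) P] FP_resolution_group_module[OF assms(1) Q] by simp_all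
  interpret Pd: group_module G "P d" by fact
  interpret P1: group_module G "P (d + 1)" by fact
  interpret Q1: group_module G "Q (d + 1)" by fact
  let ?Z = "\<phi> (d + 1) ` carrier (P (d + 1))" and ?W = "\<psi> (d + 1) ` carrier (Q (d + 1))"
  have Z: "?Z = a_kernel (P d) (P (d - 1)) (\<phi> d)" and W: "?W = a_kernel (Q d) (Q (d - 1)) (\<psi> d)"
    using FP_resolutionD(7)[OF P, of "d - 1"] FP_resolutionD(7)[OF Q, of "d - 1"] assms(2) by simp_all
  have \<phi>: "\<phi> (d + 1) \<in> linear_maps ?R (P (d + 1)) (P d)" and \<psi>: "\<psi> (d + 1) \<in> linear_maps ?R (Q (d + 1)) (Q d)"
    using FP_resolutionD(3)[OF P, of d] FP_resolutionD(3)[OF Q, of d] by simp_all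
  obtain f g h where f: "f \<in> linear_maps ?R (P d) (Q d)" and g: "g \<in> linear_maps ?R (Q d) (P d)"
    and h: "h \<in> linear_maps ?R (P d) (P (d + 1))" and fZ: "f ` ?Z \<subseteq> ?W" and gW: "g ` ?W \<subseteq> ?Z"
    and homotopy: "\<forall>x\<in>?Z. g (f x) = x \<oplus>\<^bsub>P d\<^esub> \<phi> (d + 1) (h x)"
    using resolution_comparison_maps[OF M P[folded Suc_eq_plus1] Q[folded Suc_eq_plus1] order_refl]
    unfolding Suc_eq_plus1 by (elim bexE conjE) (rule that)
  have g\<psi>: "(\<lambda>y. g (\<psi> (d + 1) y)) \<in> linear_maps ?R (Q (d + 1)) (P d)"
    by (rule linear_maps_compose[OF \<psi> g])
  have sub: "(\<lambda>y. g (\<psi> (d + 1) y)) ` carrier (Q (d + 1)) \<subseteq> ?Z" using gW by (simp only: image_image)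
  obtain g' where g': "g' \<in> linear_maps ?R (Q (d + 1)) (P (d + 1))"
    "\<And>y. y \<in> carrier (Q (d + 1)) \<Longrightarrow> \<phi> (d + 1) (g' y) = g (\<psi> (d + 1) y)"
    using projective_lift_into_image[OF Q1.left_module_axioms FP_resolutionD(2)[OF Q order_refl]
      P1.left_module_axioms Pd.left_module_axioms \<phi> g\<psi> sub] by blast
  note \<nu>'_inv = filling_norm_properties(1)[OF gP(2) \<nu>'] and \<mu>_inv = filling_norm_properties(1)[OF gQ(1) \<mu>]
  obtain C1 where C1: "\<And>x. x \<in> carrier (P d) \<Longrightarrow> \<mu> (f x) \<le> C1 * \<nu> x"
    using linear_map_bounded[OF gP(1) gQ(1) f \<nu> \<mu>_inv] by blast
  obtain C2 where C2: "\<And>y. y \<in> carrier (Q (d + 1)) \<Longrightarrow> \<nu>' (g' y) \<le> C2 * \<mu>' y"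
    using linear_map_bounded[OF gQ(2) gP(2) g'(1) \<mu>' \<nu>'_inv] by blast
  obtain C3 where C3: "\<And>x. x \<in> carrier (P d) \<Longrightarrow> \<nu>' (h x) \<le> C3 * \<nu> x"
    using linear_map_bounded[OF gP(1,2) h \<nu> \<nu>'_inv] by blast
  have bound: "induced_norm (P (d + 1)) \<nu>' (\<phi> (d + 1)) x \<le> C2 * the_enat (?FQ (C1 * k)) + C3 * k"
    if x: "x \<in> ?Z" "\<nu> x \<le> k" for x k
  proof -
    have xP: "x \<in> carrier (P d)" using x(1) unfolding Z by (simp add: a_kernel_def')
    have fx: "f x \<in> ?W" using fZ x(1) by blast
    obtain y where y: "y \<in> carrier (Q (d + 1))" "\<psi> (d + 1) y = f x"
      "\<mu>' y = induced_norm (Q (d + 1)) \<mu>' (\<psi> (d + 1)) (f x)"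
      by (rule induced_norm_attained[OF fx])
    have "\<mu> (f x) \<le> C1 * k" using C1[OF xP] mult_le_mono2[OF x(2), of C1] by (rule le_trans)
    hence y_le: "\<mu>' y \<le> the_enat (?FQ (C1 * k))"
      using filling_function_le_iff[of d Q \<psi> \<mu>' \<mu> "C1 * k" "the_enat (?FQ (C1 * k))"]
        finite(2)[of "C1 * k"] fx y(3) unfolding W by simp
    have hx: "h x \<in> carrier (P (d + 1))" "\<phi> (d + 1) (h x) \<in> carrier (P d)"
      by (rule linear_maps_closed[OF h xP], rule linear_maps_closed[OF \<phi> linear_maps_closed[OF h xP]])
    have g'y: "g' y \<in> carrier (P (d + 1))" by (rule linear_maps_closed[OF g'(1) y(1)])
    \<comment> \<open>The filling of \<open>x\<close> obtained from the optimal filling \<open>y\<close> of \<open>f x\<close>.\<close>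
    define z where "z = g' y \<oplus>\<^bsub>P (d + 1)\<^esub> \<ominus>\<^bsub>P (d + 1)\<^esub> h x"
    note neg_hx = P1.M.a_inv_closed[OF hx(1)]
    have z: "z \<in> carrier (P (d + 1))" unfolding z_def by (rule P1.M.a_closed[OF g'y neg_hx])
    have "\<phi> (d + 1) (g' y) = x \<oplus>\<^bsub>P d\<^esub> \<phi> (d + 1) (h x)"
      using homotopy x(1) by (simp only: g'(2)[OF y(1)] y(2))
    hence "\<phi> (d + 1) z = (x \<oplus>\<^bsub>P d\<^esub> \<phi> (d + 1) (h x)) \<oplus>\<^bsub>P d\<^esub> \<ominus>\<^bsub>P d\<^esub> \<phi> (d + 1) (h x)"
      unfolding z_def linear_maps_add[OF \<phi> g'y neg_hx]
        linear_maps_neg[OF P1.left_module_axioms Pd.left_module_axioms \<phi> hx(1)] by (simp only:)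
    also have "\<dots> = x" using xP hx(2) by (simp add: Pd.M.a_assoc Pd.M.r_neg)
    finally have "induced_norm (P (d + 1)) \<nu>' (\<phi> (d + 1)) x \<le> \<nu>' z"
      using induced_norm_le[OF z, of \<nu>' "\<phi> (d + 1)"] by simp
    also have "\<dots> \<le> \<nu>' (g' y) + \<nu>' (\<ominus>\<^bsub>P (d + 1)\<^esub> h x)"
      unfolding z_def by (rule invariant_norm_onD(2)[OF \<nu>'_inv g'y neg_hx])
    also have "\<dots> \<le> C2 * \<mu>' y + C3 * \<nu> x"
      by (rule add_mono[OF C2[OF y(1)] le_trans[OF invariant_norm_onD(3)[OF \<nu>'_inv hx(1)] C3[OF xP]]])
    also have "\<dots> \<le> C2 * the_enat (?FQ (C1 * k)) + C3 * k"
      by (rule add_mono[OF mult_le_mono2[OF y_le] mult_le_mono2[OF x(2)]])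
    finally show ?thesis .
  qed
  define C where "C = C1 + C2 + C3 + 1"
  show ?thesis unfolding growth_le_def
  proof (intro exI[of _ C] conjI allI)
    show "C > 0" by (simp add: C_def)
    fix k
    have "?FP k \<le> enat (C2 * the_enat (?FQ (C1 * k)) + C3 * k)"
      unfolding filling_function_le_iff Z[symmetric] using bound by blast
    hence "the_enat (?FP k) \<le> C2 * the_enat (?FQ (C1 * k)) + C3 * k"
      by (subst (asm) finite(1)) simp
    also have "?FQ (C1 * k) \<le> ?FQ (C * k + C)"
      by (rule filling_function_mono) (simp add: C_def add_mult_distrib)
    hence "the_enat (?FQ (C1 * k)) \<le> the_enat (?FQ (C * k + C))"
      by (subst (asm) (1 2) finite(2)) simp
    hence "C2 * the_enat (?FQ (C1 * k)) + C3 * k \<le> C * the_enat (?FQ (C * k + C)) + C * k"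
      by (intro add_mono mult_le_mono) (simp_all add: C_def)
    finally show "the_enat (?FP k) \<le> C * the_enat (?FQ (C * k + C)) + C * k + C" by simp
  qed
qed

theorem theorem1p3:
  fixes G :: "('g, 'y) monoid_scheme"
    and M :: "('g \<Rightarrow> int, 'm) module"
    and d :: nat
    and P :: "nat \<Rightarrow> ('g \<Rightarrow> int, 'p) module" and \<phi> :: "nat \<Rightarrow> 'p \<Rightarrow> 'p" and \<epsilon> :: "'p \<Rightarrow> 'm"
    and \<nu>' \<nu> :: "'p \<Rightarrow> nat"
    and Q :: "nat \<Rightarrow> ('g \<Rightarrow> int, 'q) module" and \<psi> :: "nat \<Rightarrow> 'q \<Rightarrow> 'q" and \<delta> :: "'q \<Rightarrow> 'm"
    and \<mu>' \<mu> :: "'q \<Rightarrow> nat"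
  assumes "group G"
    and "d > 0"
    and "left_module (group_ring G) M"
    and "type_FP (group_ring G) (d + 1) M"
    and "FP_resolution (group_ring G) (d + 1) M P \<phi> \<epsilon>"
    and "filling_norm TYPE('f1) TYPE('i1) G (P (d + 1)) \<nu>'"
    and "filling_norm TYPE('f2) TYPE('i2) G (P d) \<nu>"
    and "FP_resolution (group_ring G) (d + 1) M Q \<psi> \<delta>"
    and "filling_norm TYPE('f3) TYPE('i3) G (Q (d + 1)) \<mu>'"
    and "filling_norm TYPE('f4) TYPE('i4) G (Q d) \<mu>"
  shows "(\<forall>k>0. filling_function d P \<phi> \<nu>' \<nu> k < \<infinity>) \<and>
    growth_equiv (\<lambda>k. the_enat (filling_function d P \<phi> \<nu>' \<nu> k))
                 (\<lambda>k. the_enat (filling_function d Q \<psi> \<mu>' \<mu> k))"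
  unfolding growth_equiv_def
  using filling_function_finite[OF assms(1,2,5-7)] filling_function_growth_le[OF assms(1-3,5-10)]
    filling_function_growth_le[OF assms(1-3,8-10,5-7)]
  by (intro conjI allI impI)

end
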